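(* For $1\le K\le d_1+1$, $1\le J\le d_2+1$, the deformation equations can be written in the folded windows and dual windows as $$\partial_{u_K}\Psi_N=\mathbf U_K^{N,\Psi}\Psi_N\ (N\ge d_2),\qquad \partial_{v_J}\Psi_N=-\mathbf V_J^{N,\Psi}\Psi_N\ (N\ge d_2+J),$$ $$\partial_{u_K}\underline\Psi^{N-1}=\underline\Psi^{N-1}\underline{\mathbf U}_K^{N,\Psi}\ (N\ge1),\qquad \partial_{v_J}\underline\Psi^{N-1}=-\underline\Psi^{N-1}\underline{\mathbf V}_J^{N,\Psi}\ (N\ge J+1),$$ $$\partial_{u_K}\Phi_N=-\mathbf U_K^{N,\Phi}\Phi_N\ (N\ge d_1+K),\qquad \partial_{v_J}\Phi_N=\mathbf V_J^{N,\Phi}\Phi_N\ (N\ge d_1),$$ $$\partial_{u_K}\underline\Phi^{N-1}=-\underline\Phi^{N-1}\underline{\mathbf U}_K^{N,\Phi}\ (N\ge K+1),\qquad \partial_{v_J}\underline\Phi^{N-1}=\underline\Phi^{N-1}\underline{\mathbf V}_J^{N,\Phi}\ (N\ge1),$$ where, with $U^{N,d}_{j,K}:=\mathrm{diag}(U^K_j(N-d),\dots,U^K_j(N))$, $V^{N,d}_{j,J}:=\mathrm{diag}(V^J_j(N-d-j),\dots,V^J_j(N-j))$ and empty products equal to $\mathbf 1$, $$\mathbf U_K^{N,\Psi}=\sum_{j=0}^KU^{N,d_2}_{j,K}\mathbf a_{N+j-1}\cdots\mathbf a_N,\qquad \underline{\mathbf U}_K^{N,\Psi}=\sum_{j=0}^K\underline{\mathbf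 b}_N\cdots\underline{\mathbf b}_{N+j-1}U^{N+d_1-1,d_1}_{j,K},$$ $$\mathbf V_J^{N,\Psi}=\sum_{j=0}^JV^{N,d_2}_{j,J}\mathbf a^{N-j}\cdots\mathbf a^{N-1},\qquad \underline{\mathbf V}_J^{N,\Psi}=\sum_{j=0}^J\underline{\mathbf b}^{N-1}\cdots\underline{\mathbf b}^{N-j}V^{N+d_1-1,d_1}_{j,J},$$ $$\mathbf U_K^{N,\Phi}=\sum_{j=0}^KU^{N-j,d_1}_{j,K}\mathbf b^{N-j}\cdots\mathbf b^{N-1},\qquad \underline{\mathbf U}_K^{N,\Phi}=\sum_{j=0}^K\underline{\mathbf a}^{N-1}\cdots\underline{\mathbf a}^{N-j}U^{N+d_2-1-j,d_2}_{j,K},$$ $$\mathbf V_J^{N,\Phi}=\sum_{j=0}^JV^{N+j,d_1}_{j,J}\mathbf b_{N+j-1}\cdots\mathbf b_N,\qquad \underline{\mathbf V}_J^{N,\Phi}=\sum_{j=0}^J\underline{\mathbf a}_N\cdots\underline{\mathbf a}_{N+j-1}V^{N+j+d_2-1,d_2}_{j,J}.$$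
   Context: **Setting.** Fix integers $d_1,d_2\ge1$ and $V_1(x)=\sum_{K=1}^{d_1+1}\frac{u_K}{K}x^K$, $V_2(y)=\sum_{J=1}^{d_2+1}\frac{v_J}{J}y^J$ with $u_{d_1+1}\ne0$, $v_{d_2+1}\ne0$, and contours $\Gamma_x,\Gamma_y$ such that all integrals below converge and integrations by parts produce no boundary terms. Assume there are monic polynomials $\pi_n,\sigma_n$ of degree $n$ ($n\ge0$) with $\int_{\Gamma_x}\int_{\Gamma_y}\pi_n(x)\sigma_m(y)e^{-V_1(x)-V_2(y)+xy}\,dy\,dx=h_n\delta_{nm}$, $h_n\neq0$. The parameters $(u_K,v_J)$ vary in an open set on which this holds (contours fixed, differentiation under the integral allowed), with $\sqrt{h_n}$ chosen smoothly. Put $\psi_n(x)=\pi_n(x)e^{-V_1(x)}/\sqrt{h_n}$, $\phi_n(y)=\sigma_n(y)e^{-V_2(y)}/\sqrt{h_n}$, $\underline\psi_n(y)=\int_{\Gamma_x}e^{xy}\psi_n(x)\,dx$, $\underline\phi_n(x)=\int_{\Gamma_y}e^{xy}\phi_n(y)\,dy$. **Recursion coefficients.** There are unique numbers $\alpha_j(n)$ ($-1\le j\le d_2$), $\beta_j(n)$ ($-1\le j\le d_1$), with $\alpha_{-1}(n)=\beta_{-1}(n)=\gamma(n)=\sqrt{h_{n+1}}/\sqrt{h_n}$ and $\alpha_j(n)=\beta_j(n)=0$ for $n<j$, such that for all $n\ge0$ (terms with negative index omitted) $x\psi_n=\sum_{j=-1}^{d_2}\alpha_j(n)\psi_{n-j}$,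 $\partial_x\psi_n=-\sum_{j=-1}^{d_1}\beta_j(n+j)\psi_{n+j}$, $y\phi_n=\sum_{j=-1}^{d_1}\beta_j(n)\phi_{n-j}$. Moreover $\alpha_{d_2}(n)\ne0$ ($n\ge d_2$), $\beta_{d_1}(n)\ne0$ ($n\ge d_1$). Let $Q,P$ be the (finite band) semi-infinite matrices (indices $\ge0$) with $x\psi_n=\sum_mQ_{nm}\psi_m$, $\partial_x\psi_n=\sum_mP_{nm}\psi_m$. Put $U^K:=-\frac1K\{(Q^K)_{>0}+\frac12(Q^K)_0\}$, $V^J:=-\frac1J\{((-P^t)^J)_{>0}+\frac12((-P^t)^J)_0\}$ ($>0$: strictly upper triangular part; $0$: diagonal part), $U^K_j(n)=(U^K)_{n,n+j}$, $V^J_j(n)=(V^J)_{n,n+j}$. **Windows.** $\Psi_N=[\psi_{N-d_2},\dots,\psi_N]^t$, $\Phi_N=[\phi_{N-d_1},\dots,\phi_N]^t$, $\underline\Psi^N=[\underline\psi_N,\dots,\underline\psi_{N+d_1}]$, $\underline\Phi^N=[\underline\phi_N,\dots,\underline\phi_{N+d_2}]$. **Ladder matrices.** $\mathbf a_N(x)$ ($N\ge d_2$) is the $(d_2+1)\times(d_2+1)$ matrix with $1$'s on the first superdiagonal, last row $\frac1{\gamma(N)}(-\alpha_{d_2}(N),\dots,-\alpha_1(N),x-\alpha_0(N))$, other entries $0$; $\mathbf b_N(y)$ ($N\ge d_1$) is the $(d_1+1)\times(d_1+1)$ matrix with $1$'s on the first superdiagonal, last row $\frac1{\gamma(N)}(-\beta_{d_1}(N),\dots,-\beta_1(N),y-\beta_0(N))$,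 other entries $0$. $\mathbf a^N=\mathbf a_N^{-1}$, $\mathbf b^N=\mathbf b_N^{-1}$. For $N\ge1$, $\underline{\mathbf a}^N(x)$ is the $(d_2+1)\times(d_2+1)$ matrix with $1$'s on the first superdiagonal, first column $\frac1{\gamma(N-1)}(x-\alpha_0(N),-\alpha_1(N+1),\dots,-\alpha_{d_2}(N+d_2))^t$, other entries $0$; $\underline{\mathbf b}^N(y)$ is the $(d_1+1)\times(d_1+1)$ matrix with $1$'s on the first superdiagonal, first column $\frac1{\gamma(N-1)}(y-\beta_0(N),-\beta_1(N+1),\dots,-\beta_{d_1}(N+d_1))^t$, other entries $0$. $\underline{\mathbf a}_N=(\underline{\mathbf a}^N)^{-1}$, $\underline{\mathbf b}_N=(\underline{\mathbf b}^N)^{-1}$. *)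

theory Defs
  imports "HOL-Analysis.Analysis" "HOL-Computational_Algebra.Polynomial"
    "Jordan_Normal_Form.Gauss_Jordan_Elimination"
begin

section \<open>Potentials, contours and pairings\<close>

text \<open>
  The potential with coefficients \<open>w\<close> is \<open>\<Sum>K=1..d+1. w K / K * z ^ K\<close>; only the
  entries \<open>w 1, ..., w (d+1)\<close> matter.
\<close>

definition potential :: "nat \<Rightarrow> (nat \<Rightarrow> complex) \<Rightarrow> complex \<Rightarrow> complex" where
  "potential d w z = (\<Sum>K=1..d+1. w K / of_nat K * z ^ K)"

text \<open>
  A contour consists of finitely many piecewise smooth curves. The curves may run to infinity,
  so they are parametrised by the whole real line, and integrals along them are Lebesgue integrals.
  Finite arcs are covered by parametrising their interior.
\<close>

type_synonym contour = "(real \<Rightarrow> complex) list"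

definition is_contour :: "contour \<Rightarrow> bool" where
  "is_contour \<Gamma> \<longleftrightarrow> (\<forall>g\<in>set \<Gamma>. g piecewise_C1_differentiable_on UNIV)"

definition converges_on :: "contour \<Rightarrow> (complex \<Rightarrow> complex) \<Rightarrow> bool" where
  "converges_on \<Gamma> f \<longleftrightarrow>
     (\<forall>g\<in>set \<Gamma>. integrable lborel (\<lambda>t. f (g t) * vector_derivative g (at t)))"

definition cint :: "contour \<Rightarrow> (complex \<Rightarrow> complex) \<Rightarrow> complex" where
  "cint \<Gamma> f =
     (\<Sum>g\<leftarrow>\<Gamma>. integral\<^sup>L lborel (\<lambda>t. f (g t) * vector_derivative g (at t)))"

definition pairing :: "contour \<Rightarrow> contour \<Rightarrow> nat \<Rightarrow> nat \<Rightarrow> (nat \<Rightarrow> complex) \<Rightarrow> (nat \<Rightarrow> complex)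
    \<Rightarrow> (complex \<Rightarrow> complex) \<Rightarrow> (complex \<Rightarrow> complex) \<Rightarrow> complex" where
  "pairing \<Gamma>x \<Gamma>y d1 d2 u v f g =
     cint \<Gamma>x (\<lambda>x. cint \<Gamma>y (\<lambda>y.
       f x * g y * exp (- potential d1 u x - potential d2 v y + x * y)))"

text \<open>
  Convergence of the single and of the iterated integrals. The factor
  \<open>exp (z * s)\<close> is allowed for every complex \<open>s\<close>, since the dual functions below are
  functions on the whole complex plane.
\<close>

definition single_integrals_converge :: "contour \<Rightarrow> nat \<Rightarrow> (nat \<Rightarrow> complex) \<Rightarrow> bool" where
  "single_integrals_converge \<Gamma> d w \<longleftrightarrow>
     (\<forall>(p :: complex poly) s. converges_on \<Gamma> (\<lambda>z. poly p z * exp (- potential d w z + z * s)))"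

definition double_integrals_converge ::
    "contour \<Rightarrow> contour \<Rightarrow> nat \<Rightarrow> nat \<Rightarrow> (nat \<Rightarrow> complex) \<Rightarrow> (nat \<Rightarrow> complex) \<Rightarrow> bool" where
  "double_integrals_converge \<Gamma>x \<Gamma>y d1 d2 u v \<longleftrightarrow>
     (\<forall>(p :: complex poly) (q :: complex poly). converges_on \<Gamma>x (\<lambda>x. cint \<Gamma>y (\<lambda>y.
        poly p x * poly q y * exp (- potential d1 u x - potential d2 v y + x * y))))"

definition no_boundary_terms :: "contour \<Rightarrow> nat \<Rightarrow> (nat \<Rightarrow> complex) \<Rightarrow> bool" where
  "no_boundary_terms \<Gamma> d w \<longleftrightarrow>
     (\<forall>(p :: complex poly) s.
        cint \<Gamma> (deriv (\<lambda>z. poly p z * exp (- potential d w z + z * s))) = 0)"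

text \<open>
  Differentiation under the integral sign, for integrands whose polynomial factors do not depend
  on the parameters. The \<open>K\<close>-th parameter derivative of \<open>exp (- potential d w z)\<close> is
  \<open>- z ^ K / K\<close> times this function.
\<close>

definition single_integrals_differentiable :: "contour \<Rightarrow> nat \<Rightarrow> (nat \<Rightarrow> complex) \<Rightarrow> bool" where
  "single_integrals_differentiable \<Gamma> d w \<longleftrightarrow>
     (\<forall>K\<in>{1..d+1}. \<forall>(p :: complex poly) s.
        ((\<lambda>t. cint \<Gamma> (\<lambda>z. poly p z * exp (- potential d (w(K := t)) z + z * s)))
           has_field_derivative
         cint \<Gamma> (\<lambda>z. - (z ^ K / of_nat K) * poly p z * exp (- potential d w z + z * s)))
        (at (w K)))"

definition double_integrals_differentiable ::
    "contour \<Rightarrow> contour \<Rightarrow> nat \<Rightarrow> nat \<Rightarrow> (nat \<Rightarrow> complex) \<Rightarrow> (nat \<Rightarrow> complex) \<Rightarrow> bool" where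
  "double_integrals_differentiable \<Gamma>x \<Gamma>y d1 d2 u v \<longleftrightarrow>
     (\<forall>(p :: complex poly) (q :: complex poly).
        (\<forall>K\<in>{1..d1+1}.
           ((\<lambda>t. pairing \<Gamma>x \<Gamma>y d1 d2 (u(K := t)) v (poly p) (poly q)) has_field_derivative
            pairing \<Gamma>x \<Gamma>y d1 d2 u v (\<lambda>x. - (x ^ K / of_nat K) * poly p x) (poly q)) (at (u K))) \<and>
        (\<forall>J\<in>{1..d2+1}.
           ((\<lambda>t. pairing \<Gamma>x \<Gamma>y d1 d2 u (v(J := t)) (poly p) (poly q)) has_field_derivative
            pairing \<Gamma>x \<Gamma>y d1 d2 u v (poly p) (\<lambda>y. - (y ^ J / of_nat J) * poly q y)) (at (v J))))"

definition admissible ::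
    "contour \<Rightarrow> contour \<Rightarrow> nat \<Rightarrow> nat \<Rightarrow> (nat \<Rightarrow> complex) \<Rightarrow> (nat \<Rightarrow> complex) \<Rightarrow> bool" where
  "admissible \<Gamma>x \<Gamma>y d1 d2 u v \<longleftrightarrow>
     u (d1+1) \<noteq> 0 \<and> v (d2+1) \<noteq> 0 \<and>
     single_integrals_converge \<Gamma>x d1 u \<and> single_integrals_converge \<Gamma>y d2 v \<and>
     double_integrals_converge \<Gamma>x \<Gamma>y d1 d2 u v \<and>
     no_boundary_terms \<Gamma>x d1 u \<and> no_boundary_terms \<Gamma>y d2 v \<and>
     single_integrals_differentiable \<Gamma>x d1 u \<and> single_integrals_differentiable \<Gamma>y d2 v \<and>
     double_integrals_differentiable \<Gamma>x \<Gamma>y d1 d2 u v"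

text \<open>
  Open subsets of the parameter space \<open>\<complex>^(d1+1) \<times> \<complex>^(d2+1)\<close>, whose points
  are pairs of extensional functions on \<open>{1..d1+1}\<close> and \<open>{1..d2+1}\<close>.
\<close>

definition open_parameters ::
    "nat \<Rightarrow> nat \<Rightarrow> ((nat \<Rightarrow> complex) \<times> (nat \<Rightarrow> complex)) set \<Rightarrow> bool" where
  "open_parameters d1 d2 \<Omega> \<longleftrightarrow>
     openin (prod_topology (product_topology (\<lambda>_. euclidean) {1..d1+1})
                           (product_topology (\<lambda>_. euclidean) {1..d2+1})) \<Omega>"

section \<open>Wave functions and recursion coefficients\<close>

definition wave :: "nat \<Rightarrow> (nat \<Rightarrow> complex) \<Rightarrow> (nat \<Rightarrow> complex poly) \<Rightarrow> (nat \<Rightarrow> complex)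
    \<Rightarrow> nat \<Rightarrow> complex \<Rightarrow> complex" where
  "wave d w p r n z = poly (p n) z * exp (- potential d w z) / r n"

definition dual_wave :: "contour \<Rightarrow> (nat \<Rightarrow> complex \<Rightarrow> complex) \<Rightarrow> nat \<Rightarrow> complex \<Rightarrow> complex" where
  "dual_wave \<Gamma> f n s = cint \<Gamma> (\<lambda>z. exp (z * s) * f n z)"

text \<open>
  \<open>r n\<close> is the chosen square root of \<open>h n\<close>, so \<open>\<alpha> (-1) n = \<beta> (-1) n\<close> is
  \<open>\<gamma> n\<close>. The side conditions on the summation index omit the terms with a negative index.
\<close>

definition recursion_coefficients :: "nat \<Rightarrow> nat \<Rightarrow> (nat \<Rightarrow> complex)
    \<Rightarrow> (nat \<Rightarrow> complex \<Rightarrow> complex) \<Rightarrow> (nat \<Rightarrow> complex \<Rightarrow> complex)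
    \<Rightarrow> (int \<Rightarrow> nat \<Rightarrow> complex) \<Rightarrow> (int \<Rightarrow> nat \<Rightarrow> complex) \<Rightarrow> bool" where
  "recursion_coefficients d1 d2 r \<psi> \<phi> \<alpha> \<beta> \<longleftrightarrow>
     (\<forall>n. \<alpha> (-1) n = r (n+1) / r n \<and> \<beta> (-1) n = r (n+1) / r n) \<and>
     (\<forall>n. \<forall>j\<in>{-1..int d2}. int n < j \<longrightarrow> \<alpha> j n = 0) \<and>
     (\<forall>n. \<forall>j\<in>{-1..int d1}. int n < j \<longrightarrow> \<beta> j n = 0) \<and>
     (\<forall>n x. x * \<psi> n x =
        (\<Sum>j\<in>{j\<in>{-1..int d2}. 0 \<le> int n - j}. \<alpha> j n * \<psi> (nat (int n - j)) x)) \<and>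
     (\<forall>n x. deriv (\<psi> n) x =
        - (\<Sum>j\<in>{j\<in>{-1..int d1}. 0 \<le> int n + j}.
             \<beta> j (nat (int n + j)) * \<psi> (nat (int n + j)) x)) \<and>
     (\<forall>n y. y * \<phi> n y =
        (\<Sum>j\<in>{j\<in>{-1..int d1}. 0 \<le> int n - j}. \<beta> j n * \<phi> (nat (int n - j)) y))"

section \<open>Semi-infinite matrices\<close>

type_synonym smat = "nat \<Rightarrow> nat \<Rightarrow> complex"

definition banded :: "smat \<Rightarrow> bool" where
  "banded A \<longleftrightarrow> (\<exists>B. \<forall>n m. A n m \<noteq> 0 \<longrightarrow> n \<le> m + B \<and> m \<le> n + B)"

text \<open>For banded matrices all the sums over \<open>k\<close> or \<open>m\<close> below have finite support.\<close>

definition smat_mult :: "smat \<Rightarrow> smat \<Rightarrow> smat" where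
  "smat_mult A B = (\<lambda>n m. \<Sum>k. A n k * B k m)"

primrec smat_power :: "smat \<Rightarrow> nat \<Rightarrow> smat" where
  "smat_power A 0 = (\<lambda>n m. if n = m then 1 else 0)"
| "smat_power A (Suc K) = smat_mult A (smat_power A K)"

definition expansion_matrix :: "smat \<Rightarrow> (nat \<Rightarrow> complex \<Rightarrow> complex) \<Rightarrow> (nat \<Rightarrow> complex \<Rightarrow> complex) \<Rightarrow> bool"
  where "expansion_matrix A f g \<longleftrightarrow> banded A \<and> (\<forall>n z. g n z = (\<Sum>m. A n m * f m z))"

text \<open>
  The deformation matrices: \<open>U\<^sup>K\<close> is \<open>deformation Q K\<close> and
  \<open>V\<^sup>J\<close> is \<open>deformation (- P\<^sup>t) J\<close>.
\<close>

definition deformation :: "smat \<Rightarrow> nat \<Rightarrow> smat" where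
  "deformation A K = (\<lambda>n m. - (1 / of_nat K) *
     ((if n < m then smat_power A K n m else 0) + 1 / 2 * (if n = m then smat_power A K n m else 0)))"

definition minus_transpose :: "smat \<Rightarrow> smat" where
  "minus_transpose A = (\<lambda>n m. - A m n)"

section \<open>Windows, ladder matrices and folded deformation matrices\<close>

text \<open>Windows are matrices with a single column, dual windows matrices with a single row.\<close>

definition window :: "nat \<Rightarrow> (nat \<Rightarrow> complex \<Rightarrow> complex) \<Rightarrow> nat \<Rightarrow> complex \<Rightarrow> complex mat" where
  "window d f N z = Matrix.mat (d+1) 1 (\<lambda>(i, _). f (N - d + i) z)"

definition dual_window :: "nat \<Rightarrow> (nat \<Rightarrow> complex \<Rightarrow> complex) \<Rightarrow> nat \<Rightarrow> complex \<Rightarrow> complex mat" where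
  "dual_window d f N z = Matrix.mat 1 (d+1) (\<lambda>(_, k). f (N + k) z)"

text \<open>
  \<open>ladder d2 \<alpha>\<close> and \<open>ladder d1 \<beta>\<close> are the matrices
  \<open>a\<^sub>N\<close> and \<open>b\<^sub>N\<close>; \<open>dual_ladder d2 \<alpha>\<close> and \<open>dual_ladder d1 \<beta>\<close> are the
  underlined matrices with upper index \<open>N\<close>. The divisor \<open>c (-1)\<close> is \<open>\<gamma>\<close>.
\<close>

definition ladder :: "nat \<Rightarrow> (int \<Rightarrow> nat \<Rightarrow> complex) \<Rightarrow> complex \<Rightarrow> nat \<Rightarrow> complex mat" where
  "ladder d c z N = Matrix.mat (d+1) (d+1) (\<lambda>(i, k).
     if i = d then ((if k = d then z else 0) - c (int d - int k) N) / c (-1) N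
     else if k = i + 1 then 1 else 0)"

definition dual_ladder :: "nat \<Rightarrow> (int \<Rightarrow> nat \<Rightarrow> complex) \<Rightarrow> complex \<Rightarrow> nat \<Rightarrow> complex mat" where
  "dual_ladder d c z N = Matrix.mat (d+1) (d+1) (\<lambda>(i, k).
     if k = 0 then ((if i = 0 then z else 0) - c (int i) (N + i)) / c (-1) (N - 1)
     else if k = i + 1 then 1 else 0)"

definition minv :: "complex mat \<Rightarrow> complex mat" where
  "minv A = the (mat_inverse A)"

definition mat_prod :: "nat \<Rightarrow> complex mat list \<Rightarrow> complex mat" where
  "mat_prod k As = foldr (*) As (1\<^sub>m k)"

definition mat_sum :: "nat \<Rightarrow> complex mat list \<Rightarrow> complex mat" where
  "mat_sum k As = foldr (+) As (0\<^sub>m k k)"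

text \<open>
  \<open>diag(U\<^sub>j(N-d), ..., U\<^sub>j(N))\<close> and
  \<open>diag(V\<^sub>j(N-d-j), ..., V\<^sub>j(N-j))\<close>, where \<open>W\<^sub>j(n)\<close> is
  the entry \<open>W n (n+j)\<close>.
\<close>

definition U_block :: "smat \<Rightarrow> nat \<Rightarrow> nat \<Rightarrow> nat \<Rightarrow> complex mat" where
  "U_block U N d j = mat_diag (d+1) (\<lambda>i. U (N - d + i) (N - d + i + j))"

definition V_block :: "smat \<Rightarrow> nat \<Rightarrow> nat \<Rightarrow> nat \<Rightarrow> complex mat" where
  "V_block V N d j = mat_diag (d+1) (\<lambda>i. V (N - d - j + i) (N - d - j + i + j))"

text \<open>
  In the following definitions a matrix family that is the inverse of a given ladder family is
  written with \<open>minv\<close>: the arguments \<open>a\<close>, \<open>b\<close> are \<open>a\<^sub>N\<close>, \<open>b\<^sub>N\<close>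
  (lower index), while \<open>a'\<close>, \<open>b'\<close> are the underlined matrices with upper index \<open>N\<close>.
\<close>

definition U_psi :: "nat \<Rightarrow> smat \<Rightarrow> (nat \<Rightarrow> complex mat) \<Rightarrow> nat \<Rightarrow> nat \<Rightarrow> complex mat" where
  "U_psi d2 U a K N = mat_sum (d2+1)
     (map (\<lambda>j. U_block U N d2 j * mat_prod (d2+1) (map a (rev [N..<N+j]))) [0..<K+1])"

definition U_psi_dual :: "nat \<Rightarrow> smat \<Rightarrow> (nat \<Rightarrow> complex mat) \<Rightarrow> nat \<Rightarrow> nat \<Rightarrow> complex mat" where
  "U_psi_dual d1 U b' K N = mat_sum (d1+1)
     (map (\<lambda>j. mat_prod (d1+1) (map (\<lambda>M. minv (b' M)) [N..<N+j]) * U_block U (N+d1-1) d1 j)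
       [0..<K+1])"

definition V_psi :: "nat \<Rightarrow> smat \<Rightarrow> (nat \<Rightarrow> complex mat) \<Rightarrow> nat \<Rightarrow> nat \<Rightarrow> complex mat" where
  "V_psi d2 V a J N = mat_sum (d2+1)
     (map (\<lambda>j. V_block V N d2 j * mat_prod (d2+1) (map (\<lambda>M. minv (a M)) [N-j..<N])) [0..<J+1])"

definition V_psi_dual :: "nat \<Rightarrow> smat \<Rightarrow> (nat \<Rightarrow> complex mat) \<Rightarrow> nat \<Rightarrow> nat \<Rightarrow> complex mat" where
  "V_psi_dual d1 V b' J N = mat_sum (d1+1)
     (map (\<lambda>j. mat_prod (d1+1) (map b' (rev [N-j..<N])) * V_block V (N+d1-1) d1 j) [0..<J+1])"

definition U_phi :: "nat \<Rightarrow> smat \<Rightarrow> (nat \<Rightarrow> complex mat) \<Rightarrow> nat \<Rightarrow> nat \<Rightarrow> complex mat" where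
  "U_phi d1 U b K N = mat_sum (d1+1)
     (map (\<lambda>j. U_block U (N-j) d1 j * mat_prod (d1+1) (map (\<lambda>M. minv (b M)) [N-j..<N])) [0..<K+1])"

definition U_phi_dual :: "nat \<Rightarrow> smat \<Rightarrow> (nat \<Rightarrow> complex mat) \<Rightarrow> nat \<Rightarrow> nat \<Rightarrow> complex mat" where
  "U_phi_dual d2 U a' K N = mat_sum (d2+1)
     (map (\<lambda>j. mat_prod (d2+1) (map a' (rev [N-j..<N])) * U_block U (N+d2-1-j) d2 j) [0..<K+1])"

definition V_phi :: "nat \<Rightarrow> smat \<Rightarrow> (nat \<Rightarrow> complex mat) \<Rightarrow> nat \<Rightarrow> nat \<Rightarrow> complex mat" where
  "V_phi d1 V b J N = mat_sum (d1+1)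
     (map (\<lambda>j. V_block V (N+j) d1 j * mat_prod (d1+1) (map b (rev [N..<N+j]))) [0..<J+1])"

definition V_phi_dual :: "nat \<Rightarrow> smat \<Rightarrow> (nat \<Rightarrow> complex mat) \<Rightarrow> nat \<Rightarrow> nat \<Rightarrow> complex mat" where
  "V_phi_dual d2 V a' J N = mat_sum (d2+1)
     (map (\<lambda>j. mat_prod (d2+1) (map (\<lambda>M. minv (a' M)) [N..<N+j]) * V_block V (N+j+d2-1) d2 j)
       [0..<J+1])"

definition has_mat_derivative ::
    "(complex \<Rightarrow> complex mat) \<Rightarrow> complex mat \<Rightarrow> complex \<Rightarrow> bool" where
  "has_mat_derivative F D t \<longleftrightarrow>
     (\<forall>s. dim_row (F s) = dim_row D \<and> dim_col (F s) = dim_col D) \<and>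
     (\<forall>i<dim_row D. \<forall>k<dim_col D. ((\<lambda>s. F s $$ (i, k)) has_field_derivative D $$ (i, k)) (at t))"

end

theory Submission
  imports Defs "Jordan_Normal_Form.Determinant"
begin

text \<open>
  Everything takes place in terms of the bilinear form \<open>B\<close> on polynomials given by the pairing.
  Along a one-parameter deformation \<open>B\<close> satisfies \<open>B' (f, g) = B (w f, g)\<close> for a
  monomial \<open>w\<close>. Differentiating the biorthogonality relations determines the derivatives of the
  biorthogonal polynomials and of their norms; applying evaluations or contour integrals to the result
  yields the deformation equations of all four kinds of wave functions, in which a function with
  index \<open>n\<close> is expressed through the ones with indices \<open>n, ..., n + K\<close> or
  \<open>n - K, ..., n\<close>. Exchanging the two arguments of \<open>B\<close> turns the \<open>u\<close>-deformations
  into the \<open>v\<close>-deformations, and the matrix \<open>Q\<close> into \<open>- P\<^sup>t\<close>, which is the matrix of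
  multiplication by \<open>y\<close>.

  The recursion relations say that ladder matrices shift windows, so products of ladder matrices or
  of their inverses fold the deformation equations into a single window. The inverses exist because
  the extreme recursion coefficients do not vanish: by the string equation (integration by parts)
  they are quotients of leading coefficients of \<open>V_1'\<close> and \<open>V_2'\<close> and norming constants.
\<close>

section \<open>Functionals on polynomials\<close>

text \<open>Differentiation under the integral is assumed only for fixed polynomial factors, whereas
  the biorthogonal polynomials move with the parameters, and only the roots \<open>r n\<close> are
  assumed differentiable. So the coefficients must be shown differentiable first; after that every
  quantity is a finite sum of coefficients times moments, with a degree bound valid near the base
  point. Evaluation times the weight and integration along a contour are both linear functionals on
  polynomials, so a wave function and its dual share one computation.

  In it, the logarithmic derivative \<open>w\<close> of the weight produces a full row of the matrix
  \<open>W\<close>. The motion of the monic polynomial removes the strictly lower part of the row,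
  and the motion of the square root of the norm removes half of the diagonal: this is the origin of
  the factor 1/2. For the other family the functional is fixed, and minus the complementary half of
  a column remains. Equations that lower the index need room below, both for the index itself and
  for inverse ladder matrices; hence the different lower bounds on \<open>N\<close>.\<close>

abbreviation poly_functional :: "(complex poly \<Rightarrow> complex) \<Rightarrow> bool"
  where "poly_functional \<equiv> module_hom Polynomial.smult (*)"

lemma poly_functionalI:
  assumes "\<And>f g. E (f + g) = E f + E g" and "\<And>c f. E (Polynomial.smult c f) = c * E f"
  shows "poly_functional E"
proof unfold_locales
qed (auto simp: assms algebra_simps smult_add_right smult_add_left)

lemma poly_functional_expand:
  assumes "poly_functional E" "degree f \<le> n"
  shows "E f = (\<Sum>i\<le>n. coeff f i * E (monom 1 i))"
proof -
  interpret E: module_hom Polynomial.smult "(*)" E by fact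
  have "E f = E (\<Sum>i\<le>n. Polynomial.smult (coeff f i) (monom 1 i))"
    using poly_as_sum_of_monoms'[OF assms(2)] by (simp add: smult_monom)
  then show ?thesis by (simp add: E.sum E.scale)
qed

lemma poly_functional_cmult:
  assumes "poly_functional E" shows "poly_functional (\<lambda>f. E (w * f))"
proof -
  interpret E: module_hom Polynomial.smult "(*)" E by fact
  show ?thesis by (rule poly_functionalI) (simp_all add: distrib_left E.add E.scale)
qed

text \<open>A degree bound valid near \<open>t0\<close> turns \<open>E t (p t)\<close> into a finite
  sum of coefficients times moments, to which the ordinary product rule applies term by
  term.\<close>

lemma has_field_derivative_moving_poly:
  assumes ev: "\<forall>\<^sub>F t in nhds t0. poly_functional (E t)"
    and dE: "\<And>f. ((\<lambda>t. E t f) has_field_derivative D f) (at t0)" and D: "poly_functional D"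
    and deg: "\<forall>\<^sub>F t in nhds t0. degree (p t) \<le> n"
    and dp: "\<And>i. ((\<lambda>t. coeff (p t) i) has_field_derivative coeff p' i) (at t0)"
    and deg': "degree p' \<le> n"
  shows "((\<lambda>t. E t (p t)) has_field_derivative D (p t0) + E t0 p') (at t0)"
proof -
  have lin: "poly_functional (E t0)" and d0: "degree (p t0) \<le> n"
    using ev deg by (auto dest: eventually_nhds_x_imp_x)
  have "((\<lambda>t. \<Sum>i\<le>n. coeff (p t) i * E t (monom 1 i)) has_field_derivative
      (\<Sum>i\<le>n. coeff (p t0) i * D (monom 1 i) + coeff p' i * E t0 (monom 1 i))) (at t0)"
    by (intro DERIV_sum DERIV_mult' dp dE)
  also have "(\<Sum>i\<le>n. coeff (p t0) i * D (monom 1 i) + coeff p' i * E t0 (monom 1 i))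
      = D (p t0) + E t0 p'"
    by (simp add: sum.distrib poly_functional_expand[OF D d0] poly_functional_expand[OF lin deg'])
  finally show ?thesis
  proof (rule DERIV_cong_ev[THEN iffD1, rotated -1, OF _ refl _ refl])
    show "\<forall>\<^sub>F t in nhds t0. (\<Sum>i\<le>n. coeff (p t) i * E t (monom 1 i)) = E t (p t)"
      using ev deg by eventually_elim (simp add: poly_functional_expand)
  qed
qed

text \<open>Coefficients above \<open>n\<close> vanish near \<open>t0\<close>, hence so do their
  derivatives, and the derivatives of all coefficients assemble into a single polynomial.\<close>

lemma moving_poly_derivative:
  assumes deg: "\<forall>\<^sub>F t in nhds t0. degree (p t) \<le> n"
    and dp: "\<And>i. (\<lambda>t. coeff (p t) i) field_differentiable (at t0)"
  obtains p' :: "complex poly"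
  where "degree p' \<le> n" "\<And>i. ((\<lambda>t. coeff (p t) i) has_field_derivative coeff p' i) (at t0)"
proof -
  let ?d = "\<lambda>i. deriv (\<lambda>t. coeff (p t) i) t0"
  define p' where "p' = (\<Sum>i\<le>n. monom (?d i) i)"
  have c: "coeff p' i = (if i \<le> n then ?d i else 0)" for i
    by (simp add: p'_def coeff_sum)
  have 1: "((\<lambda>t. coeff (p t) i) has_field_derivative ?d i) (at t0)" for i
    using dp[of i] by (simp add: field_differentiable_derivI)
  have 2: "?d i = 0" if "i > n" for i
  proof -
    have "((\<lambda>t. coeff (p t) i) has_field_derivative 0) (at t0)"
    proof (rule DERIV_cong_ev[THEN iffD2, OF refl _ refl])
      show "\<forall>\<^sub>F t in nhds t0. coeff (p t) i = 0"
        using deg by eventually_elim (use that in \<open>simp add: coeff_eq_0\<close>)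
    qed auto
    then show ?thesis by (rule DERIV_imp_deriv)
  qed
  show thesis
  proof
    show "degree p' \<le> n" by (rule degree_le) (simp add: c)
    show "((\<lambda>t. coeff (p t) i) has_field_derivative coeff p' i) (at t0)" for i
      using 1[of i] 2[of i] by (cases "i \<le> n") (auto simp: c)
  qed
qed

section \<open>Biorthogonal polynomials\<close>

locale biorthogonal =
  fixes B :: "complex poly \<Rightarrow> complex poly \<Rightarrow> complex"
    and p q :: "nat \<Rightarrow> complex poly" and r :: "nat \<Rightarrow> complex"
  assumes lin_left: "poly_functional (\<lambda>f. B f g)"
    and lin_right: "poly_functional (B f)"
    and deg_p [simp]: "degree (p n) = n" and lead_p [simp]: "coeff (p n) n = 1"
    and deg_q [simp]: "degree (q n) = n" and lead_q [simp]: "coeff (q n) n = 1"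
    and orth: "B (p n) (q m) = (if n = m then (r n)\<^sup>2 else 0)"
    and r_nz [simp]: "r n \<noteq> 0"
begin

lemma swap: "biorthogonal (\<lambda>f g. B g f) q p r"
  by (intro biorthogonal.intro) (use lin_left lin_right orth in auto)

text \<open>Subtracting a multiple of the monic \<open>p n\<close> lowers the bound by one. The
  bound is put on coefficients instead of \<open>degree f < n\<close> so that \<open>n = 0\<close>
  is covered, where it means \<open>f = 0\<close>.\<close>

lemma lincomb:
  assumes "\<And>i. i \<ge> n \<Longrightarrow> coeff f i = 0"
  shows "\<exists>c. f = (\<Sum>k<n. Polynomial.smult (c k) (p k))"
  using assms
proof (induction n arbitrary: f)
  case 0
  then have "f = 0" by (intro poly_eqI) auto
  then show ?case by simp
next
  case (Suc n)
  let ?g = "f - Polynomial.smult (coeff f n) (p n)"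
  have "coeff ?g i = 0" if "i \<ge> n" for i
    using that Suc.prems[of i] by (cases "i = n") (auto simp: coeff_eq_0)
  then obtain c where c: "?g = (\<Sum>k<n. Polynomial.smult (c k) (p k))" using Suc.IH by blast
  have "f = (\<Sum>k<Suc n. Polynomial.smult ((c(n := coeff f n)) k) (p k))"
    using c by (simp add: algebra_simps)
  then show ?case by blast
qed

lemma B_lincomb: "B (\<Sum>k\<in>A. Polynomial.smult (c k) (p k)) (q m)
    = (if m \<in> A then c m * (r m)\<^sup>2 else 0)" if "finite A"
proof -
  interpret L: module_hom Polynomial.smult "(*)" "\<lambda>f. B f (q m)" by (rule lin_left)
  have "B (\<Sum>k\<in>A. Polynomial.smult (c k) (p k)) (q m) = (\<Sum>k\<in>A. if k = m then c k * (r k)\<^sup>2 else 0)"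
    by (simp add: L.sum L.scale orth if_distrib cong: if_cong)
  then show ?thesis using that by simp
qed

lemma expansion:
  assumes "\<And>i. i \<ge> n \<Longrightarrow> coeff f i = 0"
  shows "f = (\<Sum>k<n. Polynomial.smult (B f (q k) / (r k)\<^sup>2) (p k))"
proof -
  obtain c where c: "f = (\<Sum>k<n. Polynomial.smult (c k) (p k))" using lincomb assms by blast
  then have "c k = B f (q k) / (r k)\<^sup>2" if "k < n" for k
    using that by (simp add: B_lincomb)
  then show ?thesis using c by (metis (no_types, lifting) lessThan_iff sum.cong)
qed

lemma B_low:
  assumes "\<And>i. i \<ge> m \<Longrightarrow> coeff f i = 0"
  shows "B f (q m) = 0"
proof -
  obtain c where "f = (\<Sum>k<m. Polynomial.smult (c k) (p k))" using lincomb assms by blast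
  then show ?thesis by (simp add: B_lincomb)
qed

text \<open>Since \<open>p n\<close> is monic, \<open>monom 1 n - p n\<close> has no coefficients
  from \<open>n\<close> on, and orthogonality removes \<open>p n\<close> from its pairings with the
  lower \<open>q k\<close>. So \<open>p n\<close> is determined by polynomials of lower index, which
  later carries differentiability upwards.\<close>

lemma gram_schmidt:
  "p n = monom 1 n - (\<Sum>k<n. Polynomial.smult (B (monom 1 n) (q k) / (r k)\<^sup>2) (p k))"
proof -
  have 1: "coeff (monom 1 n - p n) i = 0" if "i \<ge> n" for i
    using that by (cases "i = n") (auto simp: coeff_eq_0)
  have 2: "B (monom 1 n - p n) (q k) = B (monom 1 n) (q k)" if "k < n" for k
    using that by (simp add: module_hom.diff[OF lin_left] orth)
  have "monom 1 n - p n = (\<Sum>k<n. Polynomial.smult (B (monom 1 n) (q k) / (r k)\<^sup>2) (p k))"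
    using expansion[of n "monom 1 n - p n", OF 1] 2 by simp
  then show ?thesis by (simp add: algebra_simps)
qed

end

lemma field_differentiable_cong_ev:
  assumes "\<forall>\<^sub>F t in nhds x. f t = g t" "g field_differentiable (at x)"
  shows "f field_differentiable (at x)"
  using assms DERIV_cong_ev[OF refl assms(1) refl] unfolding field_differentiable_def by blast

section \<open>Deformations of biorthogonal polynomials\<close>

text \<open>\<open>w\<close> is the logarithmic derivative of the weight in the moving parameter. It
  multiplies the left argument, so a flow in a \<open>v\<close>-parameter is an instance with the
  two arguments of \<open>B\<close> exchanged.\<close>

locale biorthogonal_flow =
  fixes B :: "complex \<Rightarrow> complex poly \<Rightarrow> complex poly \<Rightarrow> complex"
    and p q :: "complex \<Rightarrow> nat \<Rightarrow> complex poly" and r :: "complex \<Rightarrow> nat \<Rightarrow> complex"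
    and w :: "complex poly" and t0 :: complex
  assumes ev_biorthogonal: "\<forall>\<^sub>F t in nhds t0. biorthogonal (B t) (p t) (q t) (r t)"
    and deriv_B: "((\<lambda>t. B t f g) has_field_derivative B t0 (w * f) g) (at t0)"
    and diff_r: "(\<lambda>t. r t n) field_differentiable (at t0)"
begin

sublocale biorthogonal "B t0" "p t0" "q t0" "r t0"
  using ev_biorthogonal by (rule eventually_nhds_x_imp_x)

lemma moving_B_left:
  assumes "\<forall>\<^sub>F t in nhds t0. degree (f t) \<le> n" "degree f' \<le> n"
    and "\<And>i. ((\<lambda>t. coeff (f t) i) has_field_derivative coeff f' i) (at t0)"
  shows "((\<lambda>t. B t (f t) g) has_field_derivative B t0 (w * f t0) g + B t0 f' g) (at t0)"
proof (rule has_field_derivative_moving_poly[where E = "\<lambda>t f. B t f g"])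
  show "\<forall>\<^sub>F t in nhds t0. poly_functional (\<lambda>f. B t f g)"
    using ev_biorthogonal by eventually_elim (rule biorthogonal.lin_left)
  show "poly_functional (\<lambda>f. B t0 (w * f) g)"
    by (rule poly_functional_cmult[OF lin_left])
qed (use assms deriv_B in auto)

lemma moving_B_right:
  assumes "\<forall>\<^sub>F t in nhds t0. degree (g t) \<le> n" "degree g' \<le> n"
    and "\<And>i. ((\<lambda>t. coeff (g t) i) has_field_derivative coeff g' i) (at t0)"
  shows "((\<lambda>t. B t f (g t)) has_field_derivative B t0 (w * f) (g t0) + B t0 f g') (at t0)"
proof (rule has_field_derivative_moving_poly[where E = "\<lambda>t. B t f"])
  show "\<forall>\<^sub>F t in nhds t0. poly_functional (B t f)"
    using ev_biorthogonal by eventually_elim (rule biorthogonal.lin_right)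
qed (use assms deriv_B lin_right in auto)

lemma ev_deg: "\<forall>\<^sub>F t in nhds t0. degree (p t n) \<le> n" "\<forall>\<^sub>F t in nhds t0. degree (q t n) \<le> n"
  using ev_biorthogonal by (eventually_elim, simp add: biorthogonal.deg_p biorthogonal.deg_q)+

text \<open>
  By Gram-Schmidt, the coefficients of degree \<open>n\<close> are rational expressions in moments and in the
  coefficients of lower degree; this avoids determinants of moment matrices.
\<close>

lemma coeff_differentiable:
  "(\<lambda>t. coeff (p t n) i) field_differentiable (at t0) \<and>
   (\<lambda>t. coeff (q t n) i) field_differentiable (at t0)"
proof (induction n arbitrary: i rule: less_induct)
  case (less n)
  \<comment> \<open>The coefficients of \<open>p t n\<close> contain pairings with the lower
    \<open>q t k\<close>, and those of \<open>q t n\<close> pairings with the lower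
    \<open>p t k\<close>; hence one simultaneous induction.\<close>
  have p: "(\<lambda>t. B t f (q t k)) field_differentiable (at t0)" if k: "k < n" for f k
  proof -
    obtain g' where "degree g' \<le> k" "\<And>i. ((\<lambda>t. coeff (q t k) i) has_field_derivative coeff g' i) (at t0)"
      using moving_poly_derivative[OF ev_deg(2)] less.IH[OF k] by blast
    from moving_B_right[OF ev_deg(2) this] show ?thesis
      unfolding field_differentiable_def by blast
  qed
  have q: "(\<lambda>t. B t (p t k) g) field_differentiable (at t0)" if k: "k < n" for g k
  proof -
    obtain f' where "degree f' \<le> k" "\<And>i. ((\<lambda>t. coeff (p t k) i) has_field_derivative coeff f' i) (at t0)"
      using moving_poly_derivative[OF ev_deg(1)] less.IH[OF k] by blast
    from moving_B_left[OF ev_deg(1) this] show ?thesis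
      unfolding field_differentiable_def by blast
  qed
  have dp: "(\<lambda>t. coeff (monom 1 n) i - (\<Sum>k<n. B t (monom 1 n) (q t k) / (r t k)\<^sup>2 * coeff (p t k) i))
      field_differentiable (at t0)"
    using less.IH by (intro derivative_intros p diff_r) auto
  have dq: "(\<lambda>t. coeff (monom 1 n) i - (\<Sum>k<n. B t (p t k) (monom 1 n) / (r t k)\<^sup>2 * coeff (q t k) i))
      field_differentiable (at t0)"
    using less.IH by (intro derivative_intros q diff_r) auto
  have ep: "\<forall>\<^sub>F t in nhds t0. coeff (p t n) i
      = coeff (monom 1 n) i - (\<Sum>k<n. B t (monom 1 n) (q t k) / (r t k)\<^sup>2 * coeff (p t k) i)"
    using ev_biorthogonal
  proof eventually_elim
    case (elim t)
    show ?case by (subst biorthogonal.gram_schmidt[OF elim]) (simp add: coeff_sum)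
  qed
  have eq: "\<forall>\<^sub>F t in nhds t0. coeff (q t n) i
      = coeff (monom 1 n) i - (\<Sum>k<n. B t (p t k) (monom 1 n) / (r t k)\<^sup>2 * coeff (q t k) i)"
    using ev_biorthogonal
  proof eventually_elim
    case (elim t)
    show ?case
      by (subst biorthogonal.gram_schmidt[OF biorthogonal.swap[OF elim]]) (simp add: coeff_sum)
  qed
  show ?case
    using field_differentiable_cong_ev[OF ep dp] field_differentiable_cong_ev[OF eq dq] by blast
qed

section \<open>Derivatives of the monic polynomials and of the norms\<close>

definition dp :: "nat \<Rightarrow> complex poly" where
  "dp n = (SOME f. degree f \<le> n \<and> (\<forall>i. ((\<lambda>t. coeff (p t n) i) has_field_derivative coeff f i) (at t0)))"

definition dq :: "nat \<Rightarrow> complex poly" where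
  "dq n = (SOME f. degree f \<le> n \<and> (\<forall>i. ((\<lambda>t. coeff (q t n) i) has_field_derivative coeff f i) (at t0)))"

lemma dp: "degree (dp n) \<le> n" "((\<lambda>t. coeff (p t n) i) has_field_derivative coeff (dp n) i) (at t0)"
proof -
  have "\<exists>f. degree f \<le> n \<and> (\<forall>i. ((\<lambda>t. coeff (p t n) i) has_field_derivative coeff f i) (at t0))"
    using moving_poly_derivative[OF ev_deg(1)] coeff_differentiable by metis
  from someI_ex[OF this] show "degree (dp n) \<le> n"
    "((\<lambda>t. coeff (p t n) i) has_field_derivative coeff (dp n) i) (at t0)"
    by (auto simp: dp_def)
qed

lemma dq: "degree (dq n) \<le> n" "((\<lambda>t. coeff (q t n) i) has_field_derivative coeff (dq n) i) (at t0)"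
proof -
  have "\<exists>f. degree f \<le> n \<and> (\<forall>i. ((\<lambda>t. coeff (q t n) i) has_field_derivative coeff f i) (at t0))"
    using moving_poly_derivative[OF ev_deg(2)] coeff_differentiable by metis
  from someI_ex[OF this] show "degree (dq n) \<le> n"
    "((\<lambda>t. coeff (q t n) i) has_field_derivative coeff (dq n) i) (at t0)"
    by (auto simp: dq_def)
qed

text \<open>The leading coefficient is constantly 1 near \<open>t0\<close>, so differentiating in
  the parameter lowers the degree.\<close>

lemma coeff_dp_dq_ge: assumes "i \<ge> n" shows "coeff (dp n) i = 0" "coeff (dq n) i = 0"
proof -
  have "coeff (dp n) n = 0" "coeff (dq n) n = 0"
  proof -
    have "\<forall>\<^sub>F t in nhds t0. coeff (p t n) n = 1" "\<forall>\<^sub>F t in nhds t0. coeff (q t n) n = 1"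
      using ev_biorthogonal
      by (eventually_elim, simp add: biorthogonal.lead_p biorthogonal.lead_q)+
    from this[THEN DERIV_cong_ev[OF refl _ refl, THEN iffD2, OF _ DERIV_const]]
    show "coeff (dp n) n = 0" "coeff (dq n) n = 0"
      using dp(2)[of n n] dq(2)[of n n] DERIV_unique by blast+
  qed
  then show "coeff (dp n) i = 0" "coeff (dq n) i = 0"
    using assms dp(1)[of n] dq(1)[of n] by (cases "i = n"; simp add: coeff_eq_0)+
qed

text \<open>The weight and the two polynomials contribute one term each. The right polynomial is
  moved first; the result is the derivative of the functional at which the left polynomial then
  moves.\<close>

lemma derivative_pairing:
  "((\<lambda>t. B t (p t n) (q t m)) has_field_derivative
     B t0 (w * p t0 n) (q t0 m) + B t0 (p t0 n) (dq m) + B t0 (dp n) (q t0 m)) (at t0)"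
proof (rule has_field_derivative_moving_poly[where E = "\<lambda>t f. B t f (q t m)"])
  show "\<forall>\<^sub>F t in nhds t0. poly_functional (\<lambda>f. B t f (q t m))"
    using ev_biorthogonal by eventually_elim (rule biorthogonal.lin_left)
  show "poly_functional (\<lambda>f. B t0 (w * f) (q t0 m) + B t0 f (dq m))"
    by (rule poly_functionalI)
      (simp_all add: distrib_left module_hom.add[OF lin_left] module_hom.scale[OF lin_left])
  show "((\<lambda>t. B t f (q t m)) has_field_derivative B t0 (w * f) (q t0 m) + B t0 f (dq m)) (at t0)" for f
    by (rule moving_B_right[OF ev_deg(2) dq])
qed (rule ev_deg dp)+

text \<open>For \<open>m < n\<close> one differentiates the constant zero
  \<open>B t (p t n) (q t m)\<close>; the term with \<open>dq m\<close> drops out because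
  \<open>dq m\<close> lies below degree \<open>n\<close>. For \<open>m \<ge> n\<close> it is
  \<open>dp n\<close> that lies below degree \<open>m\<close>.\<close>

lemma B_dp: "B t0 (dp n) (q t0 m) = (if m < n then - B t0 (w * p t0 n) (q t0 m) else 0)"
proof (cases "m < n")
  case True
  have "\<forall>\<^sub>F t in nhds t0. B t (p t n) (q t m) = 0"
    using ev_biorthogonal by eventually_elim (use True in \<open>simp add: biorthogonal.orth\<close>)
  from DERIV_cong_ev[OF refl this refl, THEN iffD2, OF DERIV_const]
  have "B t0 (w * p t0 n) (q t0 m) + B t0 (p t0 n) (dq m) + B t0 (dp n) (q t0 m) = 0"
    using derivative_pairing DERIV_unique by blast
  moreover have "B t0 (p t0 n) (dq m) = 0"
    using biorthogonal.B_low[OF swap, of n "dq m"] coeff_dp_dq_ge[of m] True by simp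
  ultimately show ?thesis using True by (simp add: add_eq_0_iff2)
next
  case False
  then show ?thesis using B_low[of m "dp n"] coeff_dp_dq_ge by simp
qed

lemma B_dq: "B t0 (p t0 m) (dq n) = (if m < n then - B t0 (w * p t0 m) (q t0 n) else 0)"
proof (cases "m < n")
  case True
  have "\<forall>\<^sub>F t in nhds t0. B t (p t m) (q t n) = 0"
    using ev_biorthogonal by eventually_elim (use True in \<open>simp add: biorthogonal.orth\<close>)
  from DERIV_cong_ev[OF refl this refl, THEN iffD2, OF DERIV_const]
  have "B t0 (w * p t0 m) (q t0 n) + B t0 (p t0 m) (dq n) + B t0 (dp m) (q t0 n) = 0"
    using derivative_pairing DERIV_unique by blast
  moreover have "B t0 (dp m) (q t0 n) = 0"
    using B_low[of n "dp m"] coeff_dp_dq_ge[of m] True by simp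
  ultimately show ?thesis using True by (simp add: add_eq_0_iff2)
next
  case False
  then show ?thesis
    using biorthogonal.B_low[OF swap, of m "dq n"] coeff_dp_dq_ge by simp
qed

text \<open>The matrix of multiplication by \<open>w\<close> in the normalised bases; for a monomial
  \<open>w\<close> it becomes a multiple of a power of the multiplication matrix.\<close>

definition W :: "nat \<Rightarrow> nat \<Rightarrow> complex" where
  "W n m = B t0 (w * p t0 n) (q t0 m) / (r t0 n * r t0 m)"

lemma W_eq: "B t0 (w * p t0 n) (q t0 m) = W n m * r t0 n * r t0 m"
  by (simp add: W_def)

text \<open>At equal indices both polynomial derivatives pair to zero, so differentiating the
  squared norm leaves the weight term only: \<open>2 * r * r'\<close> equals \<open>W n n\<close>
  times the square of \<open>r\<close>.\<close>

lemma derivative_r: "((\<lambda>t. r t n) has_field_derivative W n n / 2 * r t0 n) (at t0)"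
proof -
  have d: "((\<lambda>t. r t n) has_field_derivative deriv (\<lambda>t. r t n) t0) (at t0)"
    using diff_r by (simp add: field_differentiable_derivI)
  have "((\<lambda>t. (r t n)\<^sup>2) has_field_derivative 2 * r t0 n * deriv (\<lambda>t. r t n) t0) (at t0)"
    by (rule derivative_eq_intros d refl | simp)+
  moreover have "\<forall>\<^sub>F t in nhds t0. B t (p t n) (q t n) = (r t n)\<^sup>2"
    using ev_biorthogonal by eventually_elim (simp add: biorthogonal.orth)
  from DERIV_cong_ev[OF refl this refl, THEN iffD1, OF derivative_pairing]
  have "((\<lambda>t. (r t n)\<^sup>2) has_field_derivative W n n * r t0 n * r t0 n) (at t0)"
    by (simp add: B_dp B_dq W_eq)
  ultimately have "2 * r t0 n * deriv (\<lambda>t. r t n) t0 = W n n * r t0 n * r t0 n"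
    by (rule DERIV_unique)
  then have "deriv (\<lambda>t. r t n) t0 = W n n / 2 * r t0 n" by (simp add: field_simps)
  with d show ?thesis by simp
qed

lemma functional_dp:
  assumes "poly_functional E"
  shows "E (dp n) = - (\<Sum>k<n. W n k * r t0 n * (E (p t0 k) / r t0 k))"
proof -
  interpret E: module_hom Polynomial.smult "(*)" E by fact
  have "dp n = (\<Sum>k<n. Polynomial.smult (B t0 (dp n) (q t0 k) / (r t0 k)\<^sup>2) (p t0 k))"
    by (rule expansion) (rule coeff_dp_dq_ge)
  then have "E (dp n) = E (\<Sum>k<n. Polynomial.smult (B t0 (dp n) (q t0 k) / (r t0 k)\<^sup>2) (p t0 k))"
    by simp
  also have "\<dots> = (\<Sum>k<n. - (W n k * r t0 n * (E (p t0 k) / r t0 k)))"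
    by (simp add: E.sum E.neg E.scale B_dp W_eq power2_eq_square)
  finally show ?thesis by (simp add: sum_negf)
qed

lemma functional_dq:
  assumes "poly_functional E"
  shows "E (dq n) = - (\<Sum>k<n. W k n * r t0 n * (E (q t0 k) / r t0 k))"
proof -
  interpret E: module_hom Polynomial.smult "(*)" E by fact
  have "dq n = (\<Sum>k<n. Polynomial.smult (B t0 (p t0 k) (dq n) / (r t0 k)\<^sup>2) (q t0 k))"
    by (rule biorthogonal.expansion[OF swap]) (rule coeff_dp_dq_ge)
  then have "E (dq n) = E (\<Sum>k<n. Polynomial.smult (B t0 (p t0 k) (dq n) / (r t0 k)\<^sup>2) (q t0 k))"
    by simp
  also have "\<dots> = (\<Sum>k<n. - (W k n * r t0 n * (E (q t0 k) / r t0 k)))"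
    by (simp add: E.sum E.neg E.scale B_dq W_eq power2_eq_square)
  finally show ?thesis by (simp add: sum_negf)
qed

lemma functional_wp:
  assumes "poly_functional E" "degree w \<le> K"
  shows "E (w * p t0 n) = (\<Sum>k\<le>n+K. W n k * r t0 n * (E (p t0 k) / r t0 k))"
proof -
  interpret E: module_hom Polynomial.smult "(*)" E by fact
  have "degree (w * p t0 n) \<le> n + K" using degree_mult_le[of w "p t0 n"] assms(2) by simp
  then have "w * p t0 n
      = (\<Sum>k<Suc (n+K). Polynomial.smult (B t0 (w * p t0 n) (q t0 k) / (r t0 k)\<^sup>2) (p t0 k))"
    by (intro expansion) (simp add: coeff_eq_0)
  then have "E (w * p t0 n)
      = E (\<Sum>k<Suc (n+K). Polynomial.smult (B t0 (w * p t0 n) (q t0 k) / (r t0 k)\<^sup>2) (p t0 k))"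
    by simp
  also have "\<dots> = (\<Sum>k<Suc (n+K). W n k * r t0 n * (E (p t0 k) / r t0 k))"
    by (simp only: E.sum E.scale W_eq) (simp add: power2_eq_square)
  finally show ?thesis by (simp only: lessThan_Suc_atMost)
qed

definition U :: "nat \<Rightarrow> nat \<Rightarrow> complex" where
  "U n m = (if n < m then W n m else if n = m then W n n / 2 else 0)"

text \<open>Three contributions combine: \<open>w\<close> under \<open>E\<close> gives row
  \<open>n\<close> of \<open>W\<close> up to column \<open>n + K\<close>, the motion of
  \<open>p\<close> cancels the columns below \<open>n\<close>, and the motion of \<open>r\<close>
  halves the diagonal entry.\<close>

lemma derivative_left_wave:
  assumes ev: "\<forall>\<^sub>F t in nhds t0. poly_functional (E t)"
    and dE: "\<And>f. ((\<lambda>t. E t f) has_field_derivative E t0 (w * f)) (at t0)"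
    and K: "degree w \<le> K"
  shows "((\<lambda>t. E t (p t n) / r t n) has_field_derivative
     (\<Sum>j\<le>K. U n (n+j) * (E t0 (p t0 (n+j)) / r t0 (n+j)))) (at t0)"
proof -
  let ?e = "\<lambda>k. E t0 (p t0 k) / r t0 k"
  have E: "poly_functional (E t0)" using ev by (rule eventually_nhds_x_imp_x)
  have 1: "((\<lambda>t. E t (p t n)) has_field_derivative E t0 (w * p t0 n) + E t0 (dp n)) (at t0)"
    by (rule has_field_derivative_moving_poly[OF ev dE poly_functional_cmult[OF E] ev_deg(1) dp(2) dp(1)])
  have "E t0 (w * p t0 n) + E t0 (dp n) = (\<Sum>k=n..n+K. W n k * r t0 n * ?e k)"
  proof -
    have "{..n+K} = {..<n} \<union> {n..n+K}" by auto
    then have "(\<Sum>k\<le>n+K. W n k * r t0 n * ?e k)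
        = (\<Sum>k<n. W n k * r t0 n * ?e k) + (\<Sum>k=n..n+K. W n k * r t0 n * ?e k)"
      by (simp add: sum.union_disjoint[symmetric] ivl_disj_int)
    then show ?thesis by (simp add: functional_wp[OF E K] functional_dp[OF E])
  qed
  also have "\<dots> = (\<Sum>j\<le>K. W n (n+j) * r t0 n * ?e (n+j))"
    by (rule sum.reindex_bij_witness[of _ "\<lambda>j. n + j" "\<lambda>k. k - n"]) auto
  finally have 2: "E t0 (w * p t0 n) + E t0 (dp n) = (\<Sum>j\<le>K. W n (n+j) * r t0 n * ?e (n+j))" .
  have 3: "((\<lambda>t. E t (p t n) / r t n) has_field_derivative
      ((E t0 (w * p t0 n) + E t0 (dp n)) * r t0 n - E t0 (p t0 n) * (W n n / 2 * r t0 n))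
        / (r t0 n * r t0 n)) (at t0)"
    by (rule DERIV_divide[OF 1 derivative_r]) simp
  have "((E t0 (w * p t0 n) + E t0 (dp n)) * r t0 n - E t0 (p t0 n) * (W n n / 2 * r t0 n))
        / (r t0 n * r t0 n) = (\<Sum>j\<le>K. W n (n+j) * ?e (n+j)) - W n n / 2 * ?e n"
  proof -
    have "(\<Sum>j\<le>K. W n (n+j) * r t0 n * ?e (n+j)) = r t0 n * (\<Sum>j\<le>K. W n (n+j) * ?e (n+j))"
      by (simp add: sum_distrib_left mult_ac)
    then show ?thesis unfolding 2 by (simp add: divide_simps) (simp add: algebra_simps)
  qed
  also have "\<dots> = (\<Sum>j\<le>K. U n (n+j) * ?e (n+j))"
    by (simp add: sum.atMost_shift U_def)
  finally show ?thesis using 3 by simp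
qed

text \<open>The functional does not move, so only \<open>dq\<close> and \<open>r\<close> contribute.
  They involve column \<open>n\<close> of \<open>W\<close> from the diagonal upwards, which is the
  same \<open>U\<close> as for left waves, transposed and with the opposite sign.\<close>

lemma derivative_right_wave:
  assumes F: "poly_functional F"
  shows "((\<lambda>t. F (q t n) / r t n) has_field_derivative
     - (\<Sum>m\<le>n. U m n * (F (q t0 m) / r t0 m))) (at t0)"
proof -
  let ?e = "\<lambda>k. F (q t0 k) / r t0 k"
  have 1: "((\<lambda>t. F (q t n)) has_field_derivative 0 + F (dq n)) (at t0)"
  proof (rule has_field_derivative_moving_poly[where E = "\<lambda>_. F" and D = "\<lambda>_. 0"])
    show "poly_functional (\<lambda>_. 0)" by (rule poly_functionalI) auto
  qed (use F ev_deg(2) dq in auto)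
  have "((\<lambda>t. F (q t n) / r t n) has_field_derivative
      ((0 + F (dq n)) * r t0 n - F (q t0 n) * (W n n / 2 * r t0 n))
        / (r t0 n * r t0 n)) (at t0)"
    by (rule DERIV_divide[OF 1 derivative_r]) simp
  also have "((0 + F (dq n)) * r t0 n - F (q t0 n) * (W n n / 2 * r t0 n)) / (r t0 n * r t0 n)
      = - (\<Sum>k<n. W k n * ?e k) - W n n / 2 * ?e n"
  proof -
    have "(\<Sum>k<n. W k n * r t0 n * ?e k) = r t0 n * (\<Sum>k<n. W k n * ?e k)"
      by (simp add: sum_distrib_left mult_ac)
    then show ?thesis unfolding functional_dq[OF F]
      by (simp add: divide_simps) (simp add: algebra_simps)
  qed
  also have "\<dots> = - (\<Sum>m\<le>n. U m n * ?e m)"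
    by (simp add: U_def lessThan_Suc_atMost[symmetric])
  finally show ?thesis .
qed

end

section \<open>Multiplication matrices and the string equation\<close>

text \<open>The entry \<open>c j n\<close> sits in row \<open>n\<close> and column
  \<open>n - j\<close>. Recursions with terms \<open>c j n\<close> are then row sums, and those with
  terms \<open>c j (n + j)\<close> are column sums of the same matrix. The coefficients \<alpha>
  give \<open>Q\<close> and \<beta> give \<open>- P\<^sup>t\<close>.\<close>

definition band :: "nat \<Rightarrow> (int \<Rightarrow> nat \<Rightarrow> complex) \<Rightarrow> smat" where
  "band d c n m = (if int n - int m \<in> {-1..int d} then c (int n - int m) n else 0)"

lemma sum_band:
  "(\<Sum>j\<in>{j\<in>{-1..int d}. 0 \<le> int n - j}. c j n * f (nat (int n - j)))
     = (\<Sum>m\<le>n+1. band d c n m * f m)"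
proof -
  have "(\<Sum>j\<in>{j\<in>{-1..int d}. 0 \<le> int n - j}. c j n * f (nat (int n - j)))
      = (\<Sum>m\<in>{m\<in>{..n+1}. int n - int m \<le> int d}. c (int n - int m) n * f m)"
    by (rule sum.reindex_bij_witness[of _ "\<lambda>m. int n - int m" "\<lambda>j. nat (int n - j)"]) auto
  also have "\<dots> = (\<Sum>m\<le>n+1. if int n - int m \<le> int d then c (int n - int m) n * f m else 0)"
    by (rule sum.inter_filter) simp
  also have "\<dots> = (\<Sum>m\<le>n+1. band d c n m * f m)"
    by (rule sum.cong) (auto simp: band_def)
  finally show ?thesis .
qed

lemma sum_band_transpose:
  "(\<Sum>j\<in>{j\<in>{-1..int d}. 0 \<le> int n + j}. c j (nat (int n + j)) * f (nat (int n + j)))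
     = (\<Sum>m\<le>n+d. band d c m n * f m)"
proof -
  have "(\<Sum>j\<in>{j\<in>{-1..int d}. 0 \<le> int n + j}. c j (nat (int n + j)) * f (nat (int n + j)))
      = (\<Sum>m\<in>{m\<in>{..n+d}. int n - 1 \<le> int m}. c (int m - int n) m * f m)"
    by (rule sum.reindex_bij_witness[of _ "\<lambda>m. int m - int n" "\<lambda>j. nat (int n + j)"]) auto
  also have "\<dots> = (\<Sum>m\<le>n+d. if int n - 1 \<le> int m then c (int m - int n) m * f m else 0)"
    by (rule sum.inter_filter) simp
  also have "\<dots> = (\<Sum>m\<le>n+d. band d c m n * f m)"
    by (rule sum.cong) (auto simp: band_def)
  finally show ?thesis .
qed

lemma suminf_banded:
  assumes "banded A"
  obtains b where "\<And>n f. (\<Sum>m. A n m * f m) = (\<Sum>m\<le>n+b. A n m * f m)" "\<And>n m. m > n + b \<Longrightarrow> A n m = 0"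
proof -
  obtain b where b: "\<And>n m. A n m \<noteq> 0 \<Longrightarrow> n \<le> m + b \<and> m \<le> n + b"
    using assms by (auto simp: banded_def)
  have z: "A n m = 0" if "m > n + b" for n m using b[of n m] that by force
  have "(\<Sum>m. A n m * f m) = (\<Sum>m\<le>n+b. A n m * f m)" for n f
    by (rule suminf_finite) (auto simp: z)
  then show ?thesis using z that by blast
qed

context biorthogonal begin

text \<open>The nowhere vanishing factor \<open>e\<close> cancels and leaves an identity of
  polynomials, whose coefficients are read off by pairing with \<open>q m\<close>.\<close>

lemma B_expansion:
  assumes wv: "\<And>n z. wv n z = poly (p n) z * e z / r n" and e: "\<And>z. e z \<noteq> 0"
    and f: "\<And>z. poly f z * e z / s = (\<Sum>m\<le>M. c m * wv m z)" and s: "s \<noteq> 0"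
  shows "B f (q m) = (if m \<le> M then s * r m * c m else 0)"
proof -
  have "poly f z = (\<Sum>m\<le>M. s * c m / r m * poly (p m) z)" for z
  proof -
    have "poly f z * e z / s = (\<Sum>m\<le>M. s * c m / r m * poly (p m) z) * e z / s"
      unfolding f wv sum_distrib_right sum_divide_distrib by (rule sum.cong) (use s in auto)
    then show ?thesis using e s by simp
  qed
  then have "f = (\<Sum>m\<le>M. Polynomial.smult (s * c m / r m) (p m))"
    by (intro poly_eq_poly_eq_iff[THEN iffD1]) (simp add: fun_eq_iff poly_sum)
  then show ?thesis by (simp add: B_lincomb power2_eq_square)
qed

lemma B_expansion_banded:
  assumes wv: "\<And>n z. wv n z = poly (p n) z * e z / r n" and e: "\<And>z. e z \<noteq> 0"
    and A: "banded A" and f: "\<And>z. poly f z * e z / s = (\<Sum>m. A n m * wv m z)" and s: "s \<noteq> 0"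
  shows "B f (q m) = s * r m * A n m"
proof -
  obtain b where b: "\<And>n f. (\<Sum>m. A n m * f m) = (\<Sum>m\<le>n+b. A n m * f m)"
    "\<And>n m. m > n + b \<Longrightarrow> A n m = 0"
    using suminf_banded[OF A] by metis
  show ?thesis
    using B_expansion[OF wv e f[unfolded b(1)] s, of m] b(2)[of n m] by auto
qed

lemma functional_expansion:
  assumes "poly_functional E" "degree f \<le> M"
  shows "E f = (\<Sum>m\<le>M. B f (q m) / r m * (E (p m) / r m))"
proof -
  interpret E: module_hom Polynomial.smult "(*)" E by fact
  have "f = (\<Sum>k<Suc M. Polynomial.smult (B f (q k) / (r k)\<^sup>2) (p k))"
    using assms(2) by (intro expansion) (simp add: coeff_eq_0)
  then have "E f = E (\<Sum>k<Suc M. Polynomial.smult (B f (q k) / (r k)\<^sup>2) (p k))" by simp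
  also have "\<dots> = (\<Sum>k<Suc M. B f (q k) / r k * (E (p k) / r k))"
    by (simp only: E.sum E.scale) (simp add: power2_eq_square)
  finally show ?thesis by (simp only: lessThan_Suc_atMost)
qed

text \<open>Everything below degree \<open>n\<close> is annihilated by \<open>q n\<close>, so only
  the coefficient of degree \<open>n\<close> counts.\<close>

lemma B_top:
  assumes "degree f \<le> n"
  shows "B f (q n) = coeff f n * (r n)\<^sup>2"
proof -
  let ?g = "f - Polynomial.smult (coeff f n) (p n)"
  have "coeff ?g i = 0" if "i \<ge> n" for i
    using that assms by (cases "i = n") (auto simp: coeff_eq_0)
  then have "B ?g (q n) = 0" by (rule B_low)
  then show ?thesis
    by (simp add: module_hom.diff[OF lin_left] module_hom.scale[OF lin_left] orth)
qed

text \<open>Defined from \<open>B\<close> alone, so that exchanging the arguments gives the matrix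
  for the other variable. The given \<open>Q\<close> and \<open>- P\<^sup>t\<close> are later
  identified with the two instances.\<close>

definition mult_matrix :: smat where
  "mult_matrix n m = B ([:0, 1:] * p n) (q m) / (r n * r m)"

lemma mult_matrix_upper: "mult_matrix n m = 0" if "m > n + 1"
  using that by (simp add: mult_matrix_def B_low coeff_eq_0)

text \<open>Expanding \<open>x * p n\<close> in the \<open>p k\<close> gives one row of the matrix,
  and the remaining power of \<open>x\<close> is absorbed into the functional applied to that
  expansion. Rows end at column \<open>n + 1\<close>, so the series in \<open>smat_mult\<close> is
  finite.\<close>

lemma smat_power_mult_matrix:
  "smat_power mult_matrix K n m = B (monom 1 K * p n) (q m) / (r n * r m)"
proof (induction K arbitrary: n m)
  case 0
  then show ?case by (simp add: orth power2_eq_square)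
next
  case (Suc K)
  have lin: "poly_functional (\<lambda>f. B (monom 1 K * f) (q m))"
    by (rule poly_functional_cmult[OF lin_left])
  have "smat_power mult_matrix (Suc K) n m = (\<Sum>k\<le>n+1. mult_matrix n k * smat_power mult_matrix K k m)"
    unfolding smat_power.simps smat_mult_def
    by (rule suminf_finite) (auto simp: mult_matrix_upper)
  also have "\<dots> = (\<Sum>k\<le>n+1. B ([:0, 1:] * p n) (q k) / r k * (B (monom 1 K * p k) (q m) / r k)) / (r n * r m)"
    by (simp only: Suc.IH mult_matrix_def sum_divide_distrib) (simp add: mult_ac)
  also have "(\<Sum>k\<le>n+1. B ([:0, 1:] * p n) (q k) / r k * (B (monom 1 K * p k) (q m) / r k))
      = B (monom 1 K * ([:0, 1:] * p n)) (q m)"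
    by (rule functional_expansion[OF lin, symmetric]) simp
  also have "monom 1 K * ([:0, 1:] * p n) = monom 1 (Suc K) * p n"
    by (simp add: monom_Suc)
  finally show ?case .
qed

text \<open>Each entry is determined by pairing with \<open>q m\<close>, so the expansion of the
  multiplication by a banded matrix is unique.\<close>

lemma mult_matrix_eqI:
  assumes wv: "\<And>n z. wv n z = poly (p n) z * e z / r n" and e: "\<And>z. e z \<noteq> 0"
    and "banded A" and "\<And>n z. z * wv n z = (\<Sum>m. A n m * wv m z)"
  shows "A = mult_matrix"
proof (intro ext)
  fix n m
  have "poly ([:0, 1:] * p n) z * e z / r n = (\<Sum>m. A n m * wv m z)" for z
    unfolding assms(4)[symmetric] by (simp add: wv)
  from B_expansion_banded[OF wv e assms(3) this r_nz, of m] show "A n m = mult_matrix n m"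
    by (simp add: mult_matrix_def)
qed

lemma mult_matrix_bandI:
  assumes wv: "\<And>n z. wv n z = poly (p n) z * e z / r n" and e: "\<And>z. e z \<noteq> 0"
    and "\<And>n z. z * wv n z = (\<Sum>m\<le>n+1. band d c n m * wv m z)"
  shows "mult_matrix = band d c"
proof (intro ext)
  fix n m
  have "poly ([:0, 1:] * p n) z * e z / r n = (\<Sum>m\<le>n+1. band d c n m * wv m z)" for z
    unfolding assms(3)[symmetric] by (simp add: wv)
  from B_expansion[OF wv e this r_nz, of m] show "mult_matrix n m = band d c n m"
    by (auto simp: mult_matrix_def band_def)
qed

text \<open>In degree \<open>n + d\<close> only leading coefficients enter: \<open>p n\<close> is
  monic and \<open>pderiv (p n)\<close> does not reach that degree. Thus
  \<open>c (int d) (n + d)\<close> is the leading coefficient of \<open>V\<close> times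
  \<open>r (n + d) / r n\<close>.\<close>

lemma string_equation_nonzero:
  assumes "\<And>n m. B (V * p n - pderiv (p n)) (q m) = r n * r m * band d c m n"
    and "degree V = d" "V \<noteq> 0"
  shows "c (int d) (n + d) \<noteq> 0"
proof -
  have "degree (V * p n - pderiv (p n)) \<le> n + d"
    by (intro degree_diff_le degree_mult_le[THEN order_trans]) (auto simp: assms degree_pderiv)
  then have "B (V * p n - pderiv (p n)) (q (n + d)) = coeff (V * p n - pderiv (p n)) (n + d) * (r (n+d))\<^sup>2"
    by (rule B_top)
  moreover have "coeff (V * p n - pderiv (p n)) (n + d) = coeff V d"
  proof -
    have "coeff (pderiv (p n)) (n + d) = 0"
      by (simp add: coeff_pderiv coeff_eq_0)
    moreover have "coeff (V * p n) (d + n) = coeff V d"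
      using coeff_mult_degree_sum[of V "p n"] assms by simp
    ultimately show ?thesis by (simp add: add.commute)
  qed
  moreover have "coeff V d \<noteq> 0" using assms by auto
  ultimately show ?thesis by (auto simp: assms(1) band_def)
qed

text \<open>Under \<open>E\<close> the operator \<open>V * f - pderiv f\<close> acts as
  multiplication by \<open>z\<close>, while its matrix is the transpose of \<open>band d c\<close>.
  Dual waves therefore obey the column form of the recursion.\<close>

lemma string_equation_recursion:
  assumes "\<And>n m. B (V * p n - pderiv (p n)) (q m) = r n * r m * band d c m n"
    and "degree V = d" and E: "poly_functional E"
    and z: "\<And>f. E (V * f - pderiv f) = z * E f"
  shows "z * (E (p n) / r n) = (\<Sum>m\<le>n+d. band d c m n * (E (p m) / r m))"
proof -
  have "degree (V * p n - pderiv (p n)) \<le> n + d"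
    by (intro degree_diff_le degree_mult_le[THEN order_trans]) (auto simp: assms degree_pderiv)
  from functional_expansion[OF E this]
  have "z * E (p n) = r n * (\<Sum>m\<le>n+d. band d c m n * (E (p m) / r m))"
    by (simp add: assms(1) z sum_distrib_left mult.assoc)
  then show ?thesis by simp
qed

end

section \<open>Flows whose logarithmic derivative is a monomial\<close>

context biorthogonal_flow begin

lemma U_eq_deformation:
  assumes "w = monom (- 1 / of_nat K) K"
  shows "U = deformation mult_matrix K"
proof -
  have "w * f = Polynomial.smult (- 1 / of_nat K) (monom 1 K * f)" for f
    by (simp add: assms smult_monom flip: mult_smult_left)
  then have "W n m = - (1 / of_nat K) * smat_power mult_matrix K n m" for n m
    by (simp add: W_def smat_power_mult_matrix module_hom.scale[OF lin_left]
        module_hom.neg[OF lin_left])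
  then show ?thesis by (auto simp: fun_eq_iff U_def deformation_def)
qed

lemma U_upper: "U n m = 0" if "m > n + degree w"
proof -
  have "degree (w * p t0 n) < m" using degree_mult_le[of w "p t0 n"] that by simp
  then have "B t0 (w * p t0 n) (q t0 m) = 0" by (intro B_low) (simp add: coeff_eq_0)
  then show ?thesis using that by (simp add: U_def W_def)
qed

lemma derivative_left_wave_deformation:
  assumes w: "w = monom (- 1 / of_nat K) K"
    and "\<forall>\<^sub>F t in nhds t0. poly_functional (E t)"
    and "\<And>f. ((\<lambda>t. E t f) has_field_derivative E t0 (w * f)) (at t0)"
  shows "((\<lambda>t. E t (p t n) / r t n) has_field_derivative
     (\<Sum>j\<le>K. deformation mult_matrix K n (n+j) * (E t0 (p t0 (n+j)) / r t0 (n+j)))) (at t0)"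
  using derivative_left_wave[OF assms(2,3), of K n] U_eq_deformation[OF w]
  by (simp add: w degree_monom_le)

text \<open>\<open>U_upper\<close> cuts the column to its last \<open>K + 1\<close> entries. The
  hypothesis \<open>K \<le> n\<close> keeps \<open>n - j\<close> clear of truncated subtraction; it
  is one source of the lower bounds on \<open>N\<close> in the equations that lower the
  index.\<close>

lemma derivative_right_wave_deformation:
  assumes w: "w = monom (- 1 / of_nat K) K" and "poly_functional F" and "K \<le> n"
  shows "((\<lambda>t. F (q t n) / r t n) has_field_derivative
     - (\<Sum>j\<le>K. deformation mult_matrix K (n-j) n * (F (q t0 (n-j)) / r t0 (n-j)))) (at t0)"
proof -
  have "(\<Sum>m\<le>n. U m n * (F (q t0 m) / r t0 m)) = (\<Sum>m=n-K..n. U m n * (F (q t0 m) / r t0 m))"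
  proof (rule sum.mono_neutral_right)
    have "degree w \<le> K" by (simp add: w degree_monom_le)
    then show "\<forall>m\<in>{..n} - {n-K..n}. U m n * (F (q t0 m) / r t0 m) = 0"
      by (auto simp: U_upper)
  qed auto
  also have "\<dots> = (\<Sum>j\<le>K. U (n-j) n * (F (q t0 (n-j)) / r t0 (n-j)))"
    by (rule sum.reindex_bij_witness[of _ "\<lambda>j. n - j" "\<lambda>m. n - m"]) (use assms(3) in auto)
  finally show ?thesis
    using derivative_right_wave[OF assms(2), of n] U_eq_deformation[OF w] by simp
qed

end

section \<open>Ladder matrices and folding\<close>

unbundle no vec_syntax

text \<open>Column \<open>N + 1\<close> holds the value to be solved for. The remaining
  \<open>d + 1\<close> columns are exactly the window ending at \<open>N\<close>, which fits because
  \<open>d \<le> N\<close>.\<close>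

lemma sum_band_row:
  assumes "d \<le> N"
  shows "(\<Sum>m\<le>N+1. band d c N m * g m)
    = c (-1) N * g (N+1) + (\<Sum>k<d+1. c (int d - int k) N * g (N - d + k))"
proof -
  have "{..N+1} = insert (N+1) ({..<N-d} \<union> {N-d..N})" by auto
  then have "(\<Sum>m\<le>N+1. band d c N m * g m) = band d c N (N+1) * g (N+1)
      + ((\<Sum>m<N-d. band d c N m * g m) + (\<Sum>m=N-d..N. band d c N m * g m))"
    by (simp add: sum.union_disjoint[symmetric] ivl_disj_int)
  also have "(\<Sum>m<N-d. band d c N m * g m) = 0"
    by (rule sum.neutral) (auto simp: band_def)
  also have "(\<Sum>m=N-d..N. band d c N m * g m) = (\<Sum>k<d+1. c (int d - int k) N * g (N - d + k))"
    by (rule sum.reindex_bij_witness[of _ "\<lambda>k. N - d + k" "\<lambda>m. m - (N - d)"])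
      (use assms in \<open>auto simp: band_def algebra_simps of_nat_diff\<close>)
  finally show ?thesis by (simp add: band_def)
qed

lemma sum_band_column:
  assumes "1 \<le> N"
  shows "(\<Sum>m\<le>N+d. band d c m N * g m)
    = c (-1) (N - 1) * g (N - 1) + (\<Sum>k<d+1. c (int k) (N + k) * g (N + k))"
proof -
  have "{..N+d} = insert (N-1) ({..<N-1} \<union> {N..N+d})" using assms by auto
  moreover have "N - 1 \<notin> {..<N-1} \<union> {N..N+d}" using assms by auto
  moreover have "{..<N-1} \<inter> {N..N+d} = {}" by auto
  ultimately have "(\<Sum>m\<le>N+d. band d c m N * g m) = band d c (N-1) N * g (N-1)
      + ((\<Sum>m<N-1. band d c m N * g m) + (\<Sum>m=N..N+d. band d c m N * g m))"
    by (simp add: sum.union_disjoint[symmetric])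
  also have "(\<Sum>m<N-1. band d c m N * g m) = 0"
    by (rule sum.neutral) (auto simp: band_def)
  also have "(\<Sum>m=N..N+d. band d c m N * g m) = (\<Sum>k<d+1. c (int k) (N + k) * g (N + k))"
    by (rule sum.reindex_bij_witness[of _ "\<lambda>k. N + k" "\<lambda>m. m - N"]) (auto simp: band_def)
  finally show ?thesis using assms by (simp add: band_def of_nat_diff)
qed

lemma ladder_carrier [simp]: "ladder d c z N \<in> carrier_mat (d+1) (d+1)"
  and dual_ladder_carrier [simp]: "dual_ladder d c z N \<in> carrier_mat (d+1) (d+1)"
  and window_carrier [simp]: "window d f N z \<in> carrier_mat (d+1) 1"
  and dual_window_carrier [simp]: "dual_window d f N z \<in> carrier_mat 1 (d+1)"
  by (auto simp: ladder_def dual_ladder_def window_def dual_window_def)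

text \<open>The last row solves the row recursion for \<open>f (N + 1)\<close>; all other rows
  merely shift the window.\<close>

lemma ladder_window:
  assumes rec: "z * f N z = (\<Sum>m\<le>N+1. band d c N m * f m z)" and "c (-1) N \<noteq> 0" "d \<le> N"
  shows "ladder d c z N * window d f N z = window d f (Suc N) z"
proof (rule eq_matI)
  fix i k assume "i < dim_row (window d f (Suc N) z)" "k < dim_col (window d f (Suc N) z)"
  then have i: "i < d + 1" and k: "k = 0" by (auto simp: window_def)
  have "(ladder d c z N * window d f N z) $$ (i, k)
      = (\<Sum>l<d+1. ladder d c z N $$ (i, l) * f (N - d + l) z)"
    using i k by (simp add: times_mat_def scalar_prod_def ladder_def window_def atLeast0LessThan)
  also have "\<dots> = f (Suc N - d + i) z"
  proof (cases "i = d")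
    case True
    have "(\<Sum>l<d+1. ladder d c z N $$ (i, l) * f (N - d + l) z)
        = (\<Sum>l<d+1. ((if l = d then z * f N z else 0) - c (int d - int l) N * f (N - d + l) z)) / c (-1) N"
      unfolding sum_divide_distrib
      by (rule sum.cong) (use True assms(3) in \<open>auto simp: ladder_def divide_simps algebra_simps\<close>)
    also have "\<dots> = f (N + 1) z"
      using assms(2) by (simp only: sum_subtractf rec sum_band_row[OF assms(3)]) simp
    finally show ?thesis using True assms(3) by simp
  next
    case False
    have "(\<Sum>l<d+1. ladder d c z N $$ (i, l) * f (N - d + l) z)
        = (\<Sum>l<d+1. if l = i + 1 then f (N - d + l) z else 0)"
      by (rule sum.cong) (use i False in \<open>auto simp: ladder_def\<close>)
    then show ?thesis using i False assms(3) by (simp add: Suc_diff_le)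
  qed
  finally show "(ladder d c z N * window d f N z) $$ (i, k) = window d f (Suc N) z $$ (i, k)"
    using i k by (simp add: window_def)
qed (auto simp: ladder_def window_def)

text \<open>The first column solves the column recursion for \<open>f (N - 1)\<close>; all other
  columns merely shift the window.\<close>

lemma dual_window_ladder:
  assumes rec: "z * f N z = (\<Sum>m\<le>N+d. band d c m N * f m z)" and "c (-1) (N - 1) \<noteq> 0" "1 \<le> N"
  shows "dual_window d f N z * dual_ladder d c z N = dual_window d f (N - 1) z"
proof (rule eq_matI)
  fix k i assume "k < dim_row (dual_window d f (N - 1) z)" "i < dim_col (dual_window d f (N - 1) z)"
  then have i: "i < d + 1" and k: "k = 0" by (auto simp: dual_window_def)
  have "(dual_window d f N z * dual_ladder d c z N) $$ (k, i)
      = (\<Sum>l<d+1. f (N + l) z * dual_ladder d c z N $$ (l, i))"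
    using i k by (simp add: times_mat_def scalar_prod_def dual_ladder_def dual_window_def atLeast0LessThan)
  also have "\<dots> = f (N - 1 + i) z"
  proof (cases "i = 0")
    case True
    have "(\<Sum>l<d+1. f (N + l) z * dual_ladder d c z N $$ (l, i))
        = (\<Sum>l<d+1. ((if l = 0 then z * f N z else 0) - c (int l) (N + l) * f (N + l) z)) / c (-1) (N - 1)"
      unfolding sum_divide_distrib
      by (rule sum.cong) (use True in \<open>auto simp: dual_ladder_def divide_simps algebra_simps\<close>)
    also have "\<dots> = f (N - 1) z"
      using assms(2) by (simp only: sum_subtractf rec sum_band_column[OF assms(3)]) simp
    finally show ?thesis using True by simp
  next
    case False
    have "(\<Sum>l<d+1. f (N + l) z * dual_ladder d c z N $$ (l, i))
        = (\<Sum>l<d+1. if l = i - 1 then f (N + l) z else 0)"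
      by (rule sum.cong) (use i False in \<open>auto simp: dual_ladder_def\<close>)
    then show ?thesis using i False assms(3) by simp
  qed
  finally show "(dual_window d f N z * dual_ladder d c z N) $$ (k, i) = dual_window d f (N - 1) z $$ (k, i)"
    using i k by (simp add: dual_window_def)
qed (auto simp: dual_ladder_def dual_window_def)

text \<open>A trivial kernel gives a nonzero determinant, hence \<open>mat_inverse\<close> returns
  an actual inverse and the \<open>the\<close> in \<open>minv\<close> is meaningful.\<close>

lemma minv_inverse:
  assumes A: "A \<in> carrier_mat n n" and inj: "\<And>v. v \<in> carrier_vec n \<Longrightarrow> A *\<^sub>v v = 0\<^sub>v n \<Longrightarrow> v = 0\<^sub>v n"
  shows "minv A \<in> carrier_mat n n" "minv A * A = 1\<^sub>m n" "A * minv A = 1\<^sub>m n"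
proof -
  have "Determinant.det A \<noteq> 0" using det_0_iff_vec_prod_zero_field[OF A] inj by blast
  from det_non_zero_imp_unit[OF A this, where b = "()"]
  have "mat_inverse A \<noteq> None" using mat_inverse(1)[OF A, where b = "()"] by blast
  then have "mat_inverse A = Some (minv A)" by (auto simp: minv_def)
  from mat_inverse(2)[OF A this]
  show "minv A \<in> carrier_mat n n" "minv A * A = 1\<^sub>m n" "A * minv A = 1\<^sub>m n" by auto
qed

text \<open>On a kernel vector the superdiagonal rows kill all components except the first, and the
  last row then reads \<open>- c (int d) N / c (-1) N * v $ 0 = 0\<close>. For \<open>d = 0\<close>
  that entry would also contain \<open>z\<close> and could vanish.\<close>

lemma ladder_inverse:
  assumes "c (int d) N \<noteq> 0" "c (-1) N \<noteq> 0" "d \<ge> 1"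
  shows "minv (ladder d c z N) \<in> carrier_mat (d+1) (d+1)"
    "minv (ladder d c z N) * ladder d c z N = 1\<^sub>m (d+1)"
proof -
  have "v = 0\<^sub>v (d+1)" if v: "v \<in> carrier_vec (d+1)" and 0: "ladder d c z N *\<^sub>v v = 0\<^sub>v (d+1)" for v
  proof -
    have row: "(\<Sum>l<d+1. ladder d c z N $$ (i, l) * v $ l) = 0" if "i < d+1" for i
    proof -
      have "(ladder d c z N *\<^sub>v v) $ i = 0" using 0 that by simp
      then show ?thesis using that v
        by (simp add: mult_mat_vec_def scalar_prod_def ladder_def atLeast0LessThan)
    qed
    have S: "v $ (i+1) = 0" if "i < d" for i
    proof -
      have "(\<Sum>l<d+1. ladder d c z N $$ (i, l) * v $ l) = (\<Sum>l<d+1. if l = i + 1 then v $ l else 0)"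
        by (rule sum.cong) (use that in \<open>auto simp: ladder_def\<close>)
      also have "\<dots> = v $ (i+1)" using that by simp
      finally show ?thesis using row[of i] that by (simp del: sum.lessThan_Suc)
    qed
    have "(\<Sum>l<d+1. ladder d c z N $$ (d, l) * v $ l)
        = (\<Sum>l<d+1. if l = 0 then - c (int d) N / c (-1) N * v $ l else 0)"
    proof (rule sum.cong)
      fix l assume "l \<in> {..<d+1}"
      then show "ladder d c z N $$ (d, l) * v $ l = (if l = 0 then - c (int d) N / c (-1) N * v $ l else 0)"
        using S[of "l - 1"] assms by (cases l) (auto simp: ladder_def)
    qed simp
    then have Z: "v $ 0 = 0" using row[of d] assms by simp
    show ?thesis
    proof (rule eq_vecI)
      fix i assume "i < dim_vec (0\<^sub>v (d+1) :: complex Matrix.vec)"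
      then show "v $ i = 0\<^sub>v (d+1) $ i" using S[of "i - 1"] Z by (cases i) auto
    qed (use v in auto)
  qed
  from minv_inverse[OF ladder_carrier this]
  show "minv (ladder d c z N) \<in> carrier_mat (d+1) (d+1)"
    "minv (ladder d c z N) * ladder d c z N = 1\<^sub>m (d+1)" by auto
qed

text \<open>The order of elimination is reversed: the last row has its only nonzero entry in the
  first column and kills \<open>v $ 0\<close>, after which the other rows kill the remaining
  components.\<close>

lemma dual_ladder_inverse:
  assumes "c (int d) (N + d) \<noteq> 0" "c (-1) (N - 1) \<noteq> 0" "d \<ge> 1"
  shows "minv (dual_ladder d c z N) \<in> carrier_mat (d+1) (d+1)"
    "dual_ladder d c z N * minv (dual_ladder d c z N) = 1\<^sub>m (d+1)"
proof -
  have "v = 0\<^sub>v (d+1)" if v: "v \<in> carrier_vec (d+1)" and 0: "dual_ladder d c z N *\<^sub>v v = 0\<^sub>v (d+1)" for v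
  proof -
    have row: "(\<Sum>l<d+1. dual_ladder d c z N $$ (i, l) * v $ l) = 0" if "i < d+1" for i
    proof -
      have "(dual_ladder d c z N *\<^sub>v v) $ i = 0" using 0 that by simp
      then show ?thesis using that v
        by (simp add: mult_mat_vec_def scalar_prod_def dual_ladder_def atLeast0LessThan)
    qed
    have "(\<Sum>l<d+1. dual_ladder d c z N $$ (d, l) * v $ l)
        = (\<Sum>l<d+1. if l = 0 then - c (int d) (N + d) / c (-1) (N - 1) * v $ l else 0)"
      by (rule sum.cong) (use assms(3) in \<open>auto simp: dual_ladder_def\<close>)
    then have Z: "v $ 0 = 0" using row[of d] assms by simp
    have S: "v $ (i+1) = 0" if "i < d" for i
    proof -
      have "(\<Sum>l<d+1. dual_ladder d c z N $$ (i, l) * v $ l) = (\<Sum>l<d+1. if l = i + 1 then v $ l else 0)"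
        by (rule sum.cong) (use that Z in \<open>auto simp: dual_ladder_def\<close>)
      also have "\<dots> = v $ (i+1)" using that by simp
      finally show ?thesis using row[of i] that by (simp del: sum.lessThan_Suc)
    qed
    show ?thesis
    proof (rule eq_vecI)
      fix i assume "i < dim_vec (0\<^sub>v (d+1) :: complex Matrix.vec)"
      then show "v $ i = 0\<^sub>v (d+1) $ i" using S[of "i - 1"] Z by (cases i) auto
    qed (use v in auto)
  qed
  from minv_inverse[OF dual_ladder_carrier this]
  show "minv (dual_ladder d c z N) \<in> carrier_mat (d+1) (d+1)"
    "dual_ladder d c z N * minv (dual_ladder d c z N) = 1\<^sub>m (d+1)" by auto
qed

section \<open>Ordered products of shift matrices\<close>

lemma mat_prod_Nil [simp]: "mat_prod k [] = 1\<^sub>m k"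
  and mat_prod_Cons [simp]: "mat_prod k (A # As) = A * mat_prod k As"
  by (simp_all add: mat_prod_def)

lemma mat_prod_carrier:
  "(\<And>A. A \<in> set As \<Longrightarrow> A \<in> carrier_mat k k) \<Longrightarrow> mat_prod k As \<in> carrier_mat k k"
  by (induction As) (auto intro: mult_carrier_mat[of _ k k])

lemma mat_prod_snoc:
  assumes "\<And>B. B \<in> set As \<Longrightarrow> B \<in> carrier_mat k k" "A \<in> carrier_mat k k"
  shows "mat_prod k (As @ [A]) = mat_prod k As * A"
  using assms
proof (induction As)
  case (Cons B As)
  then have "B \<in> carrier_mat k k" "mat_prod k As \<in> carrier_mat k k" by (auto intro: mat_prod_carrier)
  then show ?case using Cons assoc_mult_mat[of B k k "mat_prod k As" k A k] by simp
qed auto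

text \<open>The factor with the largest index acts last and so stands leftmost, which accounts for
  the reversed list.\<close>

lemma mat_prod_ascend:
  assumes "\<And>M. a M \<in> carrier_mat k k" "\<And>M. X M \<in> carrier_mat k 1"
    and "\<And>M. N \<le> M \<Longrightarrow> a M * X M = X (Suc M)"
  shows "mat_prod k (map a (rev [N..<N+j])) * X N = X (N + j)"
proof (induction j)
  case 0
  then show ?case using assms(2)[of N] by simp
next
  case (Suc j)
  have c: "mat_prod k (map a (rev [N..<N+j])) \<in> carrier_mat k k"
    by (rule mat_prod_carrier) (use assms(1) in auto)
  have "mat_prod k (map a (rev [N..<N+Suc j])) * X N
      = a (N+j) * (mat_prod k (map a (rev [N..<N+j])) * X N)"
    using assoc_mult_mat[OF assms(1) c assms(2)] by simp
  then show ?case by (simp add: Suc assms(3))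
qed

text \<open>The hypotheses are restricted to \<open>M\<close> from \<open>N - j\<close> on because
  inverse ladder matrices are available only from index \<open>d\<close> on.\<close>

lemma mat_prod_descend:
  assumes "\<And>M. N - j \<le> M \<Longrightarrow> a M \<in> carrier_mat k k" "\<And>M. X M \<in> carrier_mat k 1"
    and "\<And>M. N - j \<le> M \<Longrightarrow> a M * X (Suc M) = X M" and "j \<le> N"
  shows "mat_prod k (map a [N-j..<N]) * X N = X (N - j)"
  using assms
proof (induction j)
  case 0
  show ?case using left_mult_one_mat[OF assms(2), of N] by simp
next
  case (Suc j)
  have c: "mat_prod k (map a [N-j..<N]) \<in> carrier_mat k k"
    by (rule mat_prod_carrier) (use Suc.prems in auto)
  have "[N - Suc j..<N] = (N - Suc j) # [N-j..<N]"
    using Suc.prems(4) by (simp add: upt_conv_Cons Suc_diff_Suc)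
  then have "mat_prod k (map a [N-Suc j..<N]) * X N
      = a (N - Suc j) * (mat_prod k (map a [N-j..<N]) * X N)"
    using assoc_mult_mat[OF Suc.prems(1) c Suc.prems(2)] by simp
  also have "mat_prod k (map a [N-j..<N]) * X N = X (N - j)"
    by (rule Suc.IH) (use Suc.prems in auto)
  also have "a (N - Suc j) * X (N - j) = X (N - Suc j)"
    using Suc.prems(3)[of "N - Suc j"] Suc.prems(4) by (simp add: Suc_diff_Suc)
  finally show ?case .
qed

lemma mat_prod_ascend_dual:
  assumes "\<And>M. N \<le> M \<Longrightarrow> a M \<in> carrier_mat k k" "\<And>M. X M \<in> carrier_mat 1 k"
    and "\<And>M. N \<le> M \<Longrightarrow> X (M - 1) * a M = X M" and "1 \<le> N"
  shows "X (N - 1) * mat_prod k (map a [N..<N+j]) = X (N - 1 + j)"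
proof (induction j)
  case 0
  then show ?case using assms(2)[of "N - 1"] by simp
next
  case (Suc j)
  have c: "mat_prod k (map a [N..<N+j]) \<in> carrier_mat k k"
    by (rule mat_prod_carrier) (use assms(1) in auto)
  have a: "a (N+j) \<in> carrier_mat k k" using assms(1) by simp
  have "mat_prod k (map a [N..<N+j] @ [a (N+j)]) = mat_prod k (map a [N..<N+j]) * a (N+j)"
    by (rule mat_prod_snoc) (use a assms(1) in auto)
  then have "X (N-1) * mat_prod k (map a [N..<N+Suc j])
      = X (N-1) * mat_prod k (map a [N..<N+j]) * a (N+j)"
    using assoc_mult_mat[OF assms(2) c a, of "N-1"] by simp
  also have "X (N-1) * mat_prod k (map a [N..<N+j]) = X (N + j - 1)"
    using Suc assms(4) by simp
  also have "X (N + j - 1) * a (N+j) = X (N - 1 + Suc j)"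
    using assms(3)[of "N+j"] assms(4) by simp
  finally show ?case .
qed

lemma mat_prod_descend_dual:
  assumes "\<And>M. a M \<in> carrier_mat k k" "\<And>M. X M \<in> carrier_mat 1 k"
    and "\<And>M. 1 \<le> M \<Longrightarrow> X M * a M = X (M - 1)" and "j + 1 \<le> N"
  shows "X (N - 1) * mat_prod k (map a (rev [N-j..<N])) = X (N - 1 - j)"
  using assms(4)
proof (induction j)
  case 0
  then show ?case using assms(2)[of "N - 1"] by simp
next
  case (Suc j)
  have c: "mat_prod k (map a (rev [N-j..<N])) \<in> carrier_mat k k"
    by (rule mat_prod_carrier) (use assms(1) in auto)
  have "[N - Suc j..<N] = (N - Suc j) # [N-j..<N]"
    using Suc.prems by (simp add: upt_conv_Cons Suc_diff_Suc)
  then have "mat_prod k (map a (rev [N-Suc j..<N])) = mat_prod k (map a (rev [N-j..<N])) * a (N - Suc j)"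
    using mat_prod_snoc[OF _ assms(1), of "map a (rev [N-j..<N])" "N - Suc j"] assms(1)
    by (auto simp: rev_map)
  then have "X (N-1) * mat_prod k (map a (rev [N-Suc j..<N]))
      = X (N-1) * mat_prod k (map a (rev [N-j..<N])) * a (N - Suc j)"
    using assoc_mult_mat[OF assms(2) c assms(1)] by simp
  also have "\<dots> = X (N - 1 - j) * a (N - 1 - j)"
    using Suc by simp
  also have "\<dots> = X (N - 1 - Suc j)"
    using assms(3)[of "N - 1 - j"] Suc.prems by simp
  finally show ?case .
qed

section \<open>Folded sums and their entries\<close>

lemma mat_sum_Nil [simp]: "mat_sum k [] = 0\<^sub>m k k"
  and mat_sum_Cons [simp]: "mat_sum k (A # As) = A + mat_sum k As"
  by (simp_all add: mat_sum_def)

lemma mat_sum_carrier [simp]: "mat_sum k As \<in> carrier_mat k k"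
  by (induction As) auto

lemma dim_mat_sum [simp]: "dim_row (mat_sum k As) = k" "dim_col (mat_sum k As) = k"
  using mat_sum_carrier[of k As] by (auto simp del: mat_sum_carrier)

lemma mat_sum_mult_index:
  assumes "\<And>j. j \<in> set js \<Longrightarrow> F j \<in> carrier_mat k k" "X \<in> carrier_mat k l" "i < k" "i' < l"
  shows "(mat_sum k (map F js) * X) $$ (i, i') = (\<Sum>j\<leftarrow>js. (F j * X) $$ (i, i'))"
  using assms
proof (induction js)
  case (Cons j js)
  then have "F j \<in> carrier_mat k k" by simp
  then have "(F j + mat_sum k (map F js)) * X = F j * X + mat_sum k (map F js) * X"
    by (rule add_mult_distrib_mat[OF _ mat_sum_carrier Cons.prems(2)])
  then show ?case using Cons carrier_matD(2)[OF Cons.prems(2)] by simp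
qed auto

lemma mult_mat_sum_index:
  assumes "\<And>j. j \<in> set js \<Longrightarrow> F j \<in> carrier_mat k k" "X \<in> carrier_mat l k" "i < l" "i' < k"
  shows "(X * mat_sum k (map F js)) $$ (i, i') = (\<Sum>j\<leftarrow>js. (X * F j) $$ (i, i'))"
  using assms
proof (induction js)
  case (Cons j js)
  then have "F j \<in> carrier_mat k k" by simp
  then have "X * (F j + mat_sum k (map F js)) = X * F j + X * mat_sum k (map F js)"
    by (rule mult_add_distrib_mat[OF Cons.prems(2) _ mat_sum_carrier])
  then show ?case using Cons carrier_matD(1)[OF Cons.prems(2)] by simp
qed auto

lemma mat_diag_carrier: "mat_diag n f \<in> carrier_mat n n"
  by (simp add: mat_diag_def)

text \<open>Each product of shifts moves the window and the diagonal factor scales its entries, so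
  the folded product reproduces an unfolded sum entry by entry.\<close>

lemma folded_sum_window:
  assumes "\<And>j. j \<le> K \<Longrightarrow> A j \<in> carrier_mat (d+1) (d+1)" 
    and "\<And>j. j \<le> K \<Longrightarrow> A j * X = window d f (M j) z" and "X \<in> carrier_mat (d+1) 1" "i < d+1"
  shows "(mat_sum (d+1) (map (\<lambda>j. mat_diag (d+1) (D j) * A j) [0..<K+1]) * X) $$ (i, 0)
    = (\<Sum>j\<le>K. D j i * f (M j - d + i) z)"
proof -
  have "(mat_sum (d+1) (map (\<lambda>j. mat_diag (d+1) (D j) * A j) [0..<K+1]) * X) $$ (i, 0)
      = (\<Sum>j\<leftarrow>[0..<K+1]. (mat_diag (d+1) (D j) * A j * X) $$ (i, 0))"
    by (rule mat_sum_mult_index[where l = 1])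
      (use mult_carrier_mat[OF mat_diag_carrier assms(1)] assms(3,4) in auto)
  also have "\<dots> = (\<Sum>j\<leftarrow>[0..<K+1]. D j i * f (M j - d + i) z)"
  proof (rule arg_cong[where f = sum_list], rule map_cong[OF refl])
    fix j assume "j \<in> set [0..<K+1]"
    then have j: "j \<le> K" by auto
    have "mat_diag (d+1) (D j) * A j * X = mat_diag (d+1) (D j) * window d f (M j) z"
      using assoc_mult_mat[OF mat_diag_carrier assms(1)[OF j] assms(3)] assms(2)[OF j] by simp
    also have "\<dots> $$ (i, 0) = D j i * f (M j - d + i) z"
      using assms(4) by (subst mat_diag_mult_left[OF window_carrier]) (simp add: window_def)
    finally show "(mat_diag (d+1) (D j) * A j * X) $$ (i, 0) = D j i * f (M j - d + i) z" .
  qed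
  also have "\<dots> = (\<Sum>j\<le>K. D j i * f (M j - d + i) z)"
    by (simp only: sum_set_upt_conv_sum_list_nat[symmetric] set_upt atLeast0LessThan
        Suc_eq_plus1[symmetric] lessThan_Suc_atMost)
  finally show ?thesis .
qed

lemma folded_sum_dual_window:
  assumes "\<And>j. j \<le> K \<Longrightarrow> A j \<in> carrier_mat (d+1) (d+1)" 
    and "\<And>j. j \<le> K \<Longrightarrow> X * A j = dual_window d f (M j) z" and "X \<in> carrier_mat 1 (d+1)" "i < d+1"
  shows "(X * mat_sum (d+1) (map (\<lambda>j. A j * mat_diag (d+1) (D j)) [0..<K+1])) $$ (0, i)
    = (\<Sum>j\<le>K. D j i * f (M j + i) z)"
proof -
  have "(X * mat_sum (d+1) (map (\<lambda>j. A j * mat_diag (d+1) (D j)) [0..<K+1])) $$ (0, i)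
      = (\<Sum>j\<leftarrow>[0..<K+1]. (X * (A j * mat_diag (d+1) (D j))) $$ (0, i))"
    by (rule mult_mat_sum_index[where l = 1])
      (use mult_carrier_mat[OF assms(1) mat_diag_carrier] assms(3,4) in auto)
  also have "\<dots> = (\<Sum>j\<leftarrow>[0..<K+1]. D j i * f (M j + i) z)"
  proof (rule arg_cong[where f = sum_list], rule map_cong[OF refl])
    fix j assume "j \<in> set [0..<K+1]"
    then have j: "j \<le> K" by auto
    have "X * (A j * mat_diag (d+1) (D j)) = dual_window d f (M j) z * mat_diag (d+1) (D j)"
      using assoc_mult_mat[OF assms(3) assms(1)[OF j] mat_diag_carrier] assms(2)[OF j] by simp
    also have "\<dots> $$ (0, i) = D j i * f (M j + i) z"
      using assms(4) by (subst mat_diag_mult_right[OF dual_window_carrier]) (simp add: dual_window_def)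
    finally show "(X * (A j * mat_diag (d+1) (D j))) $$ (0, i) = D j i * f (M j + i) z" .
  qed
  also have "\<dots> = (\<Sum>j\<le>K. D j i * f (M j + i) z)"
    by (simp only: sum_set_upt_conv_sum_list_nat[symmetric] set_upt atLeast0LessThan
        Suc_eq_plus1[symmetric] lessThan_Suc_atMost)
  finally show ?thesis .
qed

lemma U_psi_window:
  assumes rec: "\<And>n. z * f n z = (\<Sum>m\<le>n+1. band d c n m * f m z)"
    and "\<And>n. c (-1) n \<noteq> 0" "d \<le> N" "i < d + 1"
  shows "(U_psi d U (ladder d c z) K N * window d f N z) $$ (i, 0)
    = (\<Sum>j\<le>K. U (N - d + i) (N - d + i + j) * f (N - d + i + j) z)"
proof -
  have *: "mat_prod (d+1) (map (ladder d c z) (rev [N..<N+j])) * window d f N z = window d f (N+j) z" for j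
    by (rule mat_prod_ascend[OF ladder_carrier window_carrier],
        rule ladder_window[where f = f, OF rec assms(2)]) (use assms(3) in auto)
  have "(U_psi d U (ladder d c z) K N * window d f N z) $$ (i, 0)
    = (\<Sum>j\<le>K. U (N - d + i) (N - d + i + j) * f (N + j - d + i) z)"
    unfolding U_psi_def U_block_def
    by (rule folded_sum_window[OF _ * window_carrier assms(4)])
      (auto intro!: mat_prod_carrier ladder_carrier[simplified])
  then show ?thesis using assms(3) by (simp add: algebra_simps)
qed

text \<open>Shifting down to \<open>N - j\<close> uses inverse ladder matrices of index at least
  \<open>N - K\<close>, and \<open>d + K \<le> N\<close> keeps these in the range where
  \<open>c (int d)\<close> does not vanish.\<close>

lemma U_phi_window:
  assumes rec: "\<And>n. z * f n z = (\<Sum>m\<le>n+1. band d c n m * f m z)"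
    and "\<And>n. c (-1) n \<noteq> 0" and "\<And>n. c (int d) (n + d) \<noteq> 0" and "1 \<le> d" "d + K \<le> N" "i < d + 1"
  shows "(U_phi d U (ladder d c z) K N * window d f N z) $$ (i, 0)
    = (\<Sum>j\<le>K. U (N - d + i - j) (N - d + i) * f (N - d + i - j) z)"
proof -
  have nz: "c (int d) M \<noteq> 0" if "d \<le> M" for M using assms(3)[of "M - d"] that by simp
  have inv: "minv (ladder d c z M) \<in> carrier_mat (d+1) (d+1)"
    "minv (ladder d c z M) * window d f (Suc M) z = window d f M z" if "d \<le> M" for M
  proof -
    note i = ladder_inverse[where c = c and z = z and N = M, OF nz assms(2) assms(4), OF that]
    show "minv (ladder d c z M) \<in> carrier_mat (d+1) (d+1)" by (rule i)
    have "ladder d c z M * window d f M z = window d f (Suc M) z"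
      using that assms by (intro ladder_window) auto
    then have "minv (ladder d c z M) * window d f (Suc M) z
        = minv (ladder d c z M) * (ladder d c z M * window d f M z)" by simp
    also have "\<dots> = minv (ladder d c z M) * ladder d c z M * window d f M z"
      by (rule assoc_mult_mat[OF i(1) ladder_carrier window_carrier, symmetric])
    also have "\<dots> = window d f M z"
      by (simp only: i(2) left_mult_one_mat[OF window_carrier])
    finally show "minv (ladder d c z M) * window d f (Suc M) z = window d f M z" .
  qed
  have *: "mat_prod (d+1) (map (\<lambda>M. minv (ladder d c z M)) [N-j..<N]) * window d f N z
      = window d f (N-j) z" if "j \<le> K" for j
    by (rule mat_prod_descend[where X = "\<lambda>M. window d f M z" and k = "d+1",
          OF inv(1) window_carrier inv(2)])
      (use assms that in auto)
  have "(U_phi d U (ladder d c z) K N * window d f N z) $$ (i, 0)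
    = (\<Sum>j\<le>K. U (N - j - d + i) (N - j - d + i + j) * f (N - j - d + i) z)"
    unfolding U_phi_def U_block_def
    by (rule folded_sum_window[OF _ * window_carrier assms(6)])
      (use inv(1) assms(5) in \<open>auto intro!: mat_prod_carrier\<close>)
  also have "\<dots> = (\<Sum>j\<le>K. U (N - d + i - j) (N - d + i) * f (N - d + i - j) z)"
  proof (rule sum.cong)
    fix j assume "j \<in> {..K}"
    then have "N - j - d + i = N - d + i - j" "N - j - d + i + j = N - d + i"
      using assms(5) by auto
    then show "U (N - j - d + i) (N - j - d + i + j) * f (N - j - d + i) z
        = U (N - d + i - j) (N - d + i) * f (N - d + i - j) z" by simp
  qed simp
  finally show ?thesis .
qed

text \<open>The dual ladder matrix of index \<open>M\<close> is controlled by
  \<open>c (int d) (M + d)\<close>, which is always in the nonvanishing range. All inverses exist,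
  and \<open>1 \<le> N\<close> suffices.\<close>

lemma U_psi_dual_window:
  assumes rec: "\<And>n. z * f n z = (\<Sum>m\<le>n+d. band d c m n * f m z)"
    and "\<And>n. c (-1) n \<noteq> 0" and "\<And>n. c (int d) (n + d) \<noteq> 0" and "1 \<le> d" "1 \<le> N" "i < d + 1"
  shows "(dual_window d f (N - 1) z * U_psi_dual d U (dual_ladder d c z) K N) $$ (0, i)
    = (\<Sum>j\<le>K. U (N - 1 + i) (N - 1 + i + j) * f (N - 1 + i + j) z)"
proof -
  have inv: "minv (dual_ladder d c z M) \<in> carrier_mat (d+1) (d+1)"
    "dual_window d f (M - 1) z * minv (dual_ladder d c z M) = dual_window d f M z" if "1 \<le> M" for M
  proof -
    note i = dual_ladder_inverse[where c = c and z = z and N = M, OF assms(3) assms(2) assms(4)]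
    show "minv (dual_ladder d c z M) \<in> carrier_mat (d+1) (d+1)" by (rule i)
    have "dual_window d f M z * dual_ladder d c z M = dual_window d f (M - 1) z"
      using that assms by (intro dual_window_ladder) auto
    then have "dual_window d f (M - 1) z * minv (dual_ladder d c z M)
        = dual_window d f M z * dual_ladder d c z M * minv (dual_ladder d c z M)" by simp
    also have "\<dots> = dual_window d f M z * (dual_ladder d c z M * minv (dual_ladder d c z M))"
      by (rule assoc_mult_mat[OF dual_window_carrier dual_ladder_carrier i(1)])
    also have "\<dots> = dual_window d f M z"
      by (simp only: i(2) right_mult_one_mat[OF dual_window_carrier])
    finally show "dual_window d f (M - 1) z * minv (dual_ladder d c z M) = dual_window d f M z" .
  qed
  have *: "dual_window d f (N - 1) z * mat_prod (d+1) (map (\<lambda>M. minv (dual_ladder d c z M)) [N..<N+j])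
      = dual_window d f (N - 1 + j) z" for j
    by (rule mat_prod_ascend_dual[where X = "\<lambda>M. dual_window d f M z" and k = "d+1",
          OF inv(1) dual_window_carrier inv(2)])
      (use assms in auto)
  have "(dual_window d f (N - 1) z * U_psi_dual d U (dual_ladder d c z) K N) $$ (0, i)
    = (\<Sum>j\<le>K. U (N + d - 1 - d + i) (N + d - 1 - d + i + j) * f (N - 1 + j + i) z)"
    unfolding U_psi_dual_def U_block_def
    by (rule folded_sum_dual_window[OF _ * dual_window_carrier assms(6)])
      (use inv(1) assms(5) in \<open>auto intro!: mat_prod_carrier\<close>)
  then show ?thesis by (simp add: algebra_simps)
qed

lemma U_phi_dual_window:
  assumes rec: "\<And>n. z * f n z = (\<Sum>m\<le>n+d. band d c m n * f m z)"
    and "\<And>n. c (-1) n \<noteq> 0" and "K + 1 \<le> N" "i < d + 1"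
  shows "(dual_window d f (N - 1) z * U_phi_dual d U (dual_ladder d c z) K N) $$ (0, i)
    = (\<Sum>j\<le>K. U (N - 1 + i - j) (N - 1 + i) * f (N - 1 + i - j) z)"
proof -
  have *: "dual_window d f (N - 1) z * mat_prod (d+1) (map (dual_ladder d c z) (rev [N-j..<N]))
      = dual_window d f (N - 1 - j) z" if "j \<le> K" for j
    by (rule mat_prod_descend_dual[OF dual_ladder_carrier dual_window_carrier],
        rule dual_window_ladder[where f = f, OF rec assms(2)]) (use that assms(3) in auto)
  have "(dual_window d f (N - 1) z * U_phi_dual d U (dual_ladder d c z) K N) $$ (0, i)
    = (\<Sum>j\<le>K. U (N + d - 1 - j - d + i) (N + d - 1 - j - d + i + j) * f (N - 1 - j + i) z)"
    unfolding U_phi_dual_def U_block_def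
    by (rule folded_sum_dual_window[OF _ * dual_window_carrier assms(4)])
      (auto intro!: mat_prod_carrier dual_ladder_carrier[simplified])
  also have "\<dots> = (\<Sum>j\<le>K. U (N - 1 + i - j) (N - 1 + i) * f (N - 1 + i - j) z)"
  proof (rule sum.cong)
    fix j assume "j \<in> {..K}"
    then have "N + d - 1 - j - d + i = N - 1 + i - j" "N + d - 1 - j - d + i + j = N - 1 + i"
      "N - 1 - j + i = N - 1 + i - j"
      using assms(3) by auto
    then show "U (N + d - 1 - j - d + i) (N + d - 1 - j - d + i + j) * f (N - 1 - j + i) z
        = U (N - 1 + i - j) (N - 1 + i) * f (N - 1 + i - j) z" by simp
  qed simp
  finally show ?thesis .
qed

text \<open>Both blocks list the same superdiagonal entries, with the window index counted from
  different ends; the identities survive truncated subtraction. They turn each of the four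
  \<open>V\<close>-sums into a \<open>U\<close>-sum, up with down of the other family.\<close>

lemma V_block_eq_U_block:
  "V_block V (N + j) d j = U_block V N d j"
  "V_block V N d j = U_block V (N - j) d j"
  by (simp_all add: V_block_def U_block_def diff_diff_add add.commute[of d j])

lemma V_phi_eq_U_psi: "V_phi = U_psi"
  by (simp add: fun_eq_iff V_phi_def U_psi_def V_block_eq_U_block(1))

lemma V_psi_eq_U_phi: "V_psi = U_phi"
  by (simp add: fun_eq_iff V_psi_def U_phi_def V_block_eq_U_block(2))

lemma V_phi_dual_eq_U_psi_dual: "V_phi_dual = U_psi_dual"
  by (simp add: fun_eq_iff V_phi_dual_def U_psi_dual_def V_block_eq_U_block(2))

lemma V_psi_dual_eq_U_phi_dual: "V_psi_dual = U_phi_dual"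
  by (simp add: fun_eq_iff V_psi_dual_def U_phi_dual_def V_block_eq_U_block(2))

section \<open>Derivatives of windows and dual windows\<close>

lemma has_mat_derivative_window:
  assumes "D \<in> carrier_mat (d+1) 1"
    and "\<And>i. i < d + 1 \<Longrightarrow> ((\<lambda>t. F t (N - d + i) z) has_field_derivative D $$ (i, 0)) (at t0)"
  shows "has_mat_derivative (\<lambda>t. window d (F t) N z) D t0"
  using assms by (auto simp: has_mat_derivative_def window_def)

lemma has_mat_derivative_dual_window:
  assumes "D \<in> carrier_mat 1 (d+1)"
    and "\<And>i. i < d + 1 \<Longrightarrow> ((\<lambda>t. F t (N + i) z) has_field_derivative D $$ (0, i)) (at t0)"
  shows "has_mat_derivative (\<lambda>t. dual_window d (F t) N z) D t0"
  using assms by (auto simp: has_mat_derivative_def dual_window_def)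

lemma U_psi_carrier: "U_psi d U a K N \<in> carrier_mat (d+1) (d+1)"
  and U_phi_carrier: "U_phi d U a K N \<in> carrier_mat (d+1) (d+1)"
  and U_psi_dual_carrier: "U_psi_dual d U a K N \<in> carrier_mat (d+1) (d+1)"
  and U_phi_dual_carrier: "U_phi_dual d U a K N \<in> carrier_mat (d+1) (d+1)"
  unfolding U_psi_def U_phi_def U_psi_dual_def U_phi_dual_def by (rule mat_sum_carrier)+

lemma has_mat_derivative_U_psi:
  assumes "\<And>n. z * f n z = (\<Sum>m\<le>n+1. band d c n m * f m z)"
    and "\<And>n. c (-1) n \<noteq> 0" "d \<le> N"
    and "\<And>n. ((\<lambda>t. F t n z) has_field_derivative (\<Sum>j\<le>K. U n (n+j) * f (n+j) z)) (at t0)"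
  shows "has_mat_derivative (\<lambda>t. window d (F t) N z) (U_psi d U (ladder d c z) K N * window d f N z) t0"
  by (rule has_mat_derivative_window[OF mult_carrier_mat[OF U_psi_carrier window_carrier]])
    (simp only: U_psi_window[where f = f and z = z and c = c, OF assms(1,2,3)] assms(4))

lemma has_mat_derivative_U_phi:
  assumes "\<And>n. z * f n z = (\<Sum>m\<le>n+1. band d c n m * f m z)"
    and "\<And>n. c (-1) n \<noteq> 0" "\<And>n. c (int d) (n + d) \<noteq> 0" "1 \<le> d" "d + K \<le> N"
    and "\<And>n. K \<le> n \<Longrightarrow>
      ((\<lambda>t. F t n z) has_field_derivative - (\<Sum>j\<le>K. U (n-j) n * f (n-j) z)) (at t0)"
  shows "has_mat_derivative (\<lambda>t. window d (F t) N z) (- (U_phi d U (ladder d c z) K N * window d f N z)) t0"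
proof (rule has_mat_derivative_window)
  let ?M = "U_phi d U (ladder d c z) K N * window d f N z"
  have M: "?M \<in> carrier_mat (d+1) 1"
    by (rule mult_carrier_mat[OF U_phi_carrier window_carrier])
  then show "- ?M \<in> carrier_mat (d+1) 1" by (rule uminus_carrier_mat)
  fix i assume i: "i < d + 1"
  have "(- ?M) $$ (i, 0) = - ?M $$ (i, 0)"
    using carrier_matD[OF M] i by (intro index_uminus_mat) simp_all
  then show "((\<lambda>t. F t (N - d + i) z) has_field_derivative (- ?M) $$ (i, 0)) (at t0)"
    using U_phi_window[where f = f and z = z and c = c, OF assms(1-5) i, of U] assms(6)[of "N - d + i"] assms(5) by simp
qed

lemma has_mat_derivative_U_psi_dual:
  assumes "\<And>n. z * f n z = (\<Sum>m\<le>n+d. band d c m n * f m z)"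
    and "\<And>n. c (-1) n \<noteq> 0" "\<And>n. c (int d) (n + d) \<noteq> 0" "1 \<le> d" "1 \<le> N"
    and "\<And>n. ((\<lambda>t. F t n z) has_field_derivative (\<Sum>j\<le>K. U n (n+j) * f (n+j) z)) (at t0)"
  shows "has_mat_derivative (\<lambda>t. dual_window d (F t) (N - 1) z)
    (dual_window d f (N - 1) z * U_psi_dual d U (dual_ladder d c z) K N) t0"
  by (rule has_mat_derivative_dual_window[OF mult_carrier_mat[OF dual_window_carrier U_psi_dual_carrier]])
    (simp only: U_psi_dual_window[where f = f and z = z and c = c, OF assms(1-5)] assms(6))

lemma has_mat_derivative_U_phi_dual:
  assumes "\<And>n. z * f n z = (\<Sum>m\<le>n+d. band d c m n * f m z)"
    and "\<And>n. c (-1) n \<noteq> 0" "K + 1 \<le> N"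
    and "\<And>n. K \<le> n \<Longrightarrow>
      ((\<lambda>t. F t n z) has_field_derivative - (\<Sum>j\<le>K. U (n-j) n * f (n-j) z)) (at t0)"
  shows "has_mat_derivative (\<lambda>t. dual_window d (F t) (N - 1) z)
    (- (dual_window d f (N - 1) z * U_phi_dual d U (dual_ladder d c z) K N)) t0"
proof (rule has_mat_derivative_dual_window)
  let ?M = "dual_window d f (N - 1) z * U_phi_dual d U (dual_ladder d c z) K N"
  have M: "?M \<in> carrier_mat 1 (d+1)"
    by (rule mult_carrier_mat[OF dual_window_carrier U_phi_dual_carrier])
  then show "- ?M \<in> carrier_mat 1 (d+1)" by (rule uminus_carrier_mat)
  fix i assume i: "i < d + 1"
  have "(- ?M) $$ (0, i) = - ?M $$ (0, i)"
    using carrier_matD[OF M] i by (intro index_uminus_mat) simp_all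
  then show "((\<lambda>t. F t (N - 1 + i) z) has_field_derivative (- ?M) $$ (0, i)) (at t0)"
    using U_phi_dual_window[where f = f and z = z and c = c, OF assms(1-3) i, of U] assms(4)[of "N - 1 + i"] assms(3) by simp
qed

section \<open>Integrals along contours\<close>

lemma cint_Nil [simp]: "cint [] f = 0"
  and cint_Cons: "cint (g # \<Gamma>) f
    = integral\<^sup>L lborel (\<lambda>t. f (g t) * vector_derivative g (at t)) + cint \<Gamma> f"
  by (simp_all add: cint_def)

lemma cint_add:
  assumes "converges_on \<Gamma> f" "converges_on \<Gamma> g"
  shows "cint \<Gamma> (\<lambda>z. f z + g z) = cint \<Gamma> f + cint \<Gamma> g"
  using assms
  by (induction \<Gamma>) (simp_all add: cint_Cons converges_on_def distrib_right)

lemma cint_cmult: "cint \<Gamma> (\<lambda>z. c * f z) = c * cint \<Gamma> f"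
  by (induction \<Gamma>) (simp_all add: cint_Cons distrib_left mult.assoc)

text \<open>As a functional of the polynomial this yields the dual waves up to \<open>r n\<close>,
  and at \<open>s = x\<close> it is also the inner integral of the pairing.\<close>

definition weighted_cint :: "contour \<Rightarrow> nat \<Rightarrow> (nat \<Rightarrow> complex) \<Rightarrow> complex \<Rightarrow> complex poly \<Rightarrow> complex" where
  "weighted_cint \<Gamma> d w s f = cint \<Gamma> (\<lambda>z. poly f z * exp (- potential d w z + z * s))"

lemma poly_functional_weighted_cint:
  assumes "single_integrals_converge \<Gamma> d w"
  shows "poly_functional (weighted_cint \<Gamma> d w s)"
proof (rule poly_functionalI)
  show "weighted_cint \<Gamma> d w s (f + g) = weighted_cint \<Gamma> d w s f + weighted_cint \<Gamma> d w s g" for f g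
    using assms by (simp add: weighted_cint_def distrib_right cint_add single_integrals_converge_def)
  show "weighted_cint \<Gamma> d w s (Polynomial.smult c f) = c * weighted_cint \<Gamma> d w s f" for c f
    by (simp add: weighted_cint_def mult.assoc cint_cmult)
qed

definition potential_deriv :: "nat \<Rightarrow> (nat \<Rightarrow> complex) \<Rightarrow> complex poly" where
  "potential_deriv d w = (\<Sum>K=1..d+1. monom (w K) (K - 1))"

lemma has_field_derivative_potential:
  "(potential d w has_field_derivative poly (potential_deriv d w) z) (at z)"
proof -
  have "((\<lambda>z. \<Sum>K=1..d+1. w K / of_nat K * z ^ K) has_field_derivative
      (\<Sum>K=1..d+1. w K / of_nat K * (of_nat K * (1 * z ^ (K - Suc 0))))) (at z)"
    by (intro DERIV_sum DERIV_cmult DERIV_power DERIV_ident)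
  also have "(\<Sum>K=1..d+1. w K / of_nat K * (of_nat K * (1 * z ^ (K - Suc 0))))
      = poly (potential_deriv d w) z"
    by (simp add: potential_deriv_def poly_sum poly_monom)
  finally show ?thesis by (simp add: potential_def[abs_def])
qed

lemma degree_potential_deriv:
  assumes "w (d+1) \<noteq> 0"
  shows "degree (potential_deriv d w) = d" "potential_deriv d w \<noteq> 0"
proof -
  have c: "coeff (potential_deriv d w) i = (if i \<le> d then w (i+1) else 0)" for i
  proof -
    have "coeff (potential_deriv d w) i = (\<Sum>K=1..d+1. if K = i + 1 then w K else 0)"
      unfolding potential_deriv_def coeff_sum by (rule sum.cong) auto
    then show ?thesis by simp
  qed
  then have "coeff (potential_deriv d w) d \<noteq> 0" using assms by simp
  moreover have "degree (potential_deriv d w) \<le> d" by (rule degree_le) (simp add: c)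
  ultimately show "degree (potential_deriv d w) = d" "potential_deriv d w \<noteq> 0"
    by (auto intro: antisym le_degree)
qed

text \<open>The derivative of the integrand has polynomial factor
  \<open>pderiv f - potential_deriv d w * f\<close> plus \<open>s\<close> times \<open>f\<close>,
  and its integral vanishes because there are no boundary terms.\<close>

lemma weighted_cint_by_parts:
  assumes "no_boundary_terms \<Gamma> d w" "single_integrals_converge \<Gamma> d w"
  shows "weighted_cint \<Gamma> d w s (potential_deriv d w * f - pderiv f) = s * weighted_cint \<Gamma> d w s f"
proof -
  interpret E: module_hom Polynomial.smult "(*)" "weighted_cint \<Gamma> d w s"
    by (rule poly_functional_weighted_cint[OF assms(2)])
  let ?g = "pderiv f - potential_deriv d w * f + Polynomial.smult s f"
  have "deriv (\<lambda>z. poly f z * exp (- potential d w z + z * s)) z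
      = poly ?g z * exp (- potential d w z + z * s)" for z
    by (rule DERIV_imp_deriv)
      (rule derivative_eq_intros has_field_derivative_potential poly_DERIV refl | simp add: algebra_simps)+
  then have "deriv (\<lambda>z. poly f z * exp (- potential d w z + z * s))
      = (\<lambda>z. poly ?g z * exp (- potential d w z + z * s))" by blast
  then have "weighted_cint \<Gamma> d w s ?g = 0"
    using assms(1) unfolding no_boundary_terms_def weighted_cint_def by metis
  then show ?thesis by (simp add: E.add E.diff E.scale algebra_simps)
qed

text \<open>For fixed \<open>x\<close> the exponential splits off its part without \<open>y\<close>.
  Facts about a single contour thereby apply under the pairing.\<close>

lemma cint_inner:
  "cint \<Gamma>y (\<lambda>y. c * poly g y * exp (- a - potential d v y + x * y))
     = c * exp (- a) * weighted_cint \<Gamma>y d v x g"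
proof -
  have "exp (- a - potential d v y + x * y) = exp (- a) * exp (- potential d v y + y * x)" for y
    by (simp add: mult_exp_exp algebra_simps)
  then have "(\<lambda>y. c * poly g y * exp (- a - potential d v y + x * y))
      = (\<lambda>y. (c * exp (- a)) * (poly g y * exp (- potential d v y + y * x)))"
    by (simp add: fun_eq_iff)
  then show ?thesis by (simp only: cint_cmult weighted_cint_def)
qed

lemma pairing_weighted_cint:
  "pairing \<Gamma>x \<Gamma>y d1 d2 u v f (poly g)
     = cint \<Gamma>x (\<lambda>x. f x * exp (- potential d1 u x) * weighted_cint \<Gamma>y d2 v x g)"
  by (simp only: pairing_def cint_inner)

lemma double_converges:
  assumes "double_integrals_converge \<Gamma>x \<Gamma>y d1 d2 u v"
  shows "converges_on \<Gamma>x (\<lambda>x. poly f x * exp (- potential d1 u x) * weighted_cint \<Gamma>y d2 v x g)"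
  using assms by (simp only: double_integrals_converge_def cint_inner)

lemma poly_functional_pairing_left:
  assumes "double_integrals_converge \<Gamma>x \<Gamma>y d1 d2 u v"
  shows "poly_functional (\<lambda>f. pairing \<Gamma>x \<Gamma>y d1 d2 u v (poly f) (poly g))"
proof (rule poly_functionalI)
  show "pairing \<Gamma>x \<Gamma>y d1 d2 u v (poly (f1 + f2)) (poly g)
    = pairing \<Gamma>x \<Gamma>y d1 d2 u v (poly f1) (poly g) + pairing \<Gamma>x \<Gamma>y d1 d2 u v (poly f2) (poly g)" for f1 f2
    by (simp add: pairing_weighted_cint distrib_right cint_add double_converges[OF assms])
  show "pairing \<Gamma>x \<Gamma>y d1 d2 u v (poly (Polynomial.smult c f)) (poly g)
    = c * pairing \<Gamma>x \<Gamma>y d1 d2 u v (poly f) (poly g)" for c f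
    by (simp add: pairing_weighted_cint mult.assoc cint_cmult)
qed

lemma poly_functional_pairing_right:
  assumes "double_integrals_converge \<Gamma>x \<Gamma>y d1 d2 u v" "single_integrals_converge \<Gamma>y d2 v"
  shows "poly_functional (\<lambda>g. pairing \<Gamma>x \<Gamma>y d1 d2 u v (poly f) (poly g))"
proof (rule poly_functionalI)
  note lin = poly_functional_weighted_cint[OF assms(2)]
  show "pairing \<Gamma>x \<Gamma>y d1 d2 u v (poly f) (poly (g1 + g2))
    = pairing \<Gamma>x \<Gamma>y d1 d2 u v (poly f) (poly g1) + pairing \<Gamma>x \<Gamma>y d1 d2 u v (poly f) (poly g2)" for g1 g2
    unfolding pairing_weighted_cint module_hom.add[OF lin] distrib_left
    by (rule cint_add[OF double_converges[OF assms(1)] double_converges[OF assms(1)]])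
  show "pairing \<Gamma>x \<Gamma>y d1 d2 u v (poly f) (poly (Polynomial.smult c g))
    = c * pairing \<Gamma>x \<Gamma>y d1 d2 u v (poly f) (poly g)" for c g
    unfolding pairing_weighted_cint module_hom.scale[OF lin] 
    by (simp only: mult.left_commute[of _ c] cint_cmult)
qed

text \<open>Integrating by parts in the inner integral, where \<open>s = x\<close>, produces a
  factor \<open>x\<close> that moves to the left argument.\<close>

lemma pairing_by_parts:
  assumes "no_boundary_terms \<Gamma>y d2 v" "single_integrals_converge \<Gamma>y d2 v"
  shows "pairing \<Gamma>x \<Gamma>y d1 d2 u v (poly f) (poly (potential_deriv d2 v * g - pderiv g))
    = pairing \<Gamma>x \<Gamma>y d1 d2 u v (poly ([:0, 1:] * f)) (poly g)"
  unfolding pairing_weighted_cint weighted_cint_by_parts[OF assms]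
  by (simp add: mult_ac)

section \<open>Dual waves and parameter derivatives of the weights\<close>

lemma dual_wave_weighted_cint:
  "dual_wave \<Gamma> (wave d w p r) n s = weighted_cint \<Gamma> d w s (p n) / r n"
proof -
  have "exp (z * s) * (poly (p n) z * exp (- potential d w z) / r n)
      = 1 / r n * (poly (p n) z * exp (- potential d w z + z * s))" for z
    unfolding exp_add by simp
  then show ?thesis
    unfolding dual_wave_def wave_def by (simp only: cint_cmult weighted_cint_def) simp
qed

lemma potential_upd:
  assumes "K \<in> {1..d+1}"
  shows "potential d (w(K := t)) z = potential d w z + (t - w K) / of_nat K * z ^ K"
proof -
  have "potential d (w(K := t)) z
      = (\<Sum>i=1..d+1. w i / of_nat i * z ^ i + (if i = K then (t - w K) / of_nat K * z ^ K else 0))"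
    unfolding potential_def by (rule sum.cong) (auto simp: diff_divide_distrib algebra_simps)
  then show ?thesis using assms by (simp add: sum.distrib potential_def)
qed

lemma has_field_derivative_weight:
  assumes "K \<in> {1..d+1}"
  shows "((\<lambda>t. poly f z * exp (- potential d (w(K := t)) z)) has_field_derivative
    poly (monom (- 1 / of_nat K) K * f) z * exp (- potential d w z)) (at (w K))"
proof -
  have "((\<lambda>t. potential d w z + (t - w K) * (z ^ K / of_nat K)) has_field_derivative
      0 + (1 - 0) * (z ^ K / of_nat K)) (at (w K))"
    by (intro DERIV_add DERIV_const DERIV_cmult_right DERIV_diff DERIV_ident)
  then have *: "((\<lambda>t. potential d (w(K := t)) z) has_field_derivative z ^ K / of_nat K) (at (w K))"
    by (simp add: potential_upd[OF assms])
  show ?thesis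
    by (rule derivative_eq_intros * refl | simp add: poly_monom)+
qed

lemma has_field_derivative_weighted_cint:
  assumes "single_integrals_differentiable \<Gamma> d w" "K \<in> {1..d+1}"
  shows "((\<lambda>t. weighted_cint \<Gamma> d (w(K := t)) s f) has_field_derivative
    weighted_cint \<Gamma> d w s (monom (- 1 / of_nat K) K * f)) (at (w K))"
  using assms unfolding single_integrals_differentiable_def weighted_cint_def
  by (simp add: poly_monom)

lemma poly_functional_weight: "poly_functional (\<lambda>f. poly f z * e)"
  by (rule poly_functionalI) (simp_all add: algebra_simps)

section \<open>Families of biorthogonal polynomials\<close>

lemma continuous_map_fun_upd:
  assumes "f \<in> extensional I" "k \<in> I"
  shows "continuous_map euclidean (product_topology (\<lambda>_. euclidean) I) (\<lambda>t. f(k := t))"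
  unfolding continuous_map_componentwise
proof (intro conjI ballI)
  show "(\<lambda>t. f(k := t)) ` topspace euclidean \<subseteq> extensional I"
    using assms by (auto simp: extensional_def)
  fix i show "continuous_map euclidean euclidean (\<lambda>t. (f(k := t)) i)"
    by (cases "i = k") auto
qed

text \<open>A coordinate line through the point is a continuous curve in the parameter space, so the
  preimage of \<open>\<Omega>\<close> under it is open. Changing a value inside the index set
  preserves extensionality.\<close>

lemma eventually_parameter:
  assumes "open_parameters d1 d2 \<Omega>" "(u, v) \<in> \<Omega>"
  shows "K \<in> {1..d1+1} \<Longrightarrow> \<forall>\<^sub>F t in nhds (u K). (u(K := t), v) \<in> \<Omega>"
    and "J \<in> {1..d2+1} \<Longrightarrow> \<forall>\<^sub>F t in nhds (v J). (u, v(J := t)) \<in> \<Omega>"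
proof -
  let ?X = "\<lambda>d. product_topology (\<lambda>_. euclidean) {1..d+1} :: (nat \<Rightarrow> complex) topology"
  have op: "openin (prod_topology (?X d1) (?X d2)) \<Omega>"
    using assms(1) by (simp add: open_parameters_def)
  have "(u, v) \<in> topspace (prod_topology (?X d1) (?X d2))"
    using openin_subset[OF op] assms(2) by blast
  then have uv: "u \<in> topspace (?X d1)" "v \<in> topspace (?X d2)"
    and ext: "u \<in> extensional {1..d1+1}" "v \<in> extensional {1..d2+1}"
    by (auto simp: PiE_def)
  have ev: "\<forall>\<^sub>F t in nhds x. \<gamma> t \<in> \<Omega>"
    if "continuous_map euclidean (prod_topology (?X d1) (?X d2)) \<gamma>" "\<gamma> x = (u, v)"
    for \<gamma> and x :: complex
  proof -
    have "open {t. \<gamma> t \<in> \<Omega>}" using openin_continuous_map_preimage[OF that(1) op] by simp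
    then show ?thesis
      unfolding eventually_nhds using that(2) assms(2) by (intro exI[of _ "{t. \<gamma> t \<in> \<Omega>}"]) auto
  qed
  show "\<forall>\<^sub>F t in nhds (u K). (u(K := t), v) \<in> \<Omega>" if "K \<in> {1..d1+1}"
  proof (rule ev)
    show "continuous_map euclidean (prod_topology (?X d1) (?X d2)) (\<lambda>t. (u(K := t), v))"
      by (intro continuous_map_pairedI continuous_map_fun_upd ext that) (use uv in simp)
  qed simp
  show "\<forall>\<^sub>F t in nhds (v J). (u, v(J := t)) \<in> \<Omega>" if "J \<in> {1..d2+1}"
  proof (rule ev)
    show "continuous_map euclidean (prod_topology (?X d1) (?X d2)) (\<lambda>t. (u, v(J := t)))"
      by (intro continuous_map_pairedI continuous_map_fun_upd ext that) (use uv in simp)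
  qed simp
qed

locale biorthogonal_family =
  fixes d1 d2 :: nat and \<Gamma>x \<Gamma>y :: contour
    and \<Omega> :: "((nat \<Rightarrow> complex) \<times> (nat \<Rightarrow> complex)) set"
    and \<pi> \<sigma> :: "(nat \<Rightarrow> complex) \<Rightarrow> (nat \<Rightarrow> complex) \<Rightarrow> nat \<Rightarrow> complex poly"
    and r :: "(nat \<Rightarrow> complex) \<Rightarrow> (nat \<Rightarrow> complex) \<Rightarrow> nat \<Rightarrow> complex"
  assumes open_\<Omega>: "open_parameters d1 d2 \<Omega>"
    and adm: "\<And>u v. (u, v) \<in> \<Omega> \<Longrightarrow> admissible \<Gamma>x \<Gamma>y d1 d2 u v"
    and monic_\<pi>: "\<And>u v n. (u, v) \<in> \<Omega> \<Longrightarrow> degree (\<pi> u v n) = n \<and> lead_coeff (\<pi> u v n) = 1"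
    and monic_\<sigma>: "\<And>u v n. (u, v) \<in> \<Omega> \<Longrightarrow> degree (\<sigma> u v n) = n \<and> lead_coeff (\<sigma> u v n) = 1"
    and orthogonal: "\<And>u v n m. (u, v) \<in> \<Omega> \<Longrightarrow>
      pairing \<Gamma>x \<Gamma>y d1 d2 u v (poly (\<pi> u v n)) (poly (\<sigma> u v m)) = (if n = m then (r u v n)\<^sup>2 else 0)"
    and r_nonzero: "\<And>u v n. (u, v) \<in> \<Omega> \<Longrightarrow> r u v n \<noteq> 0"
    and r_diff_u: "\<And>u v n K. (u, v) \<in> \<Omega> \<Longrightarrow> K \<in> {1..d1+1} \<Longrightarrow>
      (\<lambda>t. r (u(K := t)) v n) field_differentiable (at (u K))"
    and r_diff_v: "\<And>u v n J. (u, v) \<in> \<Omega> \<Longrightarrow> J \<in> {1..d2+1} \<Longrightarrow>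
      (\<lambda>t. r u (v(J := t)) n) field_differentiable (at (v J))"
begin

abbreviation B :: "(nat \<Rightarrow> complex) \<Rightarrow> (nat \<Rightarrow> complex) \<Rightarrow> complex poly \<Rightarrow> complex poly \<Rightarrow> complex" where
  "B u v f g \<equiv> pairing \<Gamma>x \<Gamma>y d1 d2 u v (poly f) (poly g)"

abbreviation \<psi> where "\<psi> u v \<equiv> wave d1 u (\<pi> u v) (r u v)"
abbreviation \<phi> where "\<phi> u v \<equiv> wave d2 v (\<sigma> u v) (r u v)"
abbreviation \<psi>' where "\<psi>' u v \<equiv> dual_wave \<Gamma>x (\<psi> u v)"
abbreviation \<phi>' where "\<phi>' u v \<equiv> dual_wave \<Gamma>y (\<phi> u v)"

lemma converge_x: "(u, v) \<in> \<Omega> \<Longrightarrow> single_integrals_converge \<Gamma>x d1 u"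
  and converge_y: "(u, v) \<in> \<Omega> \<Longrightarrow> single_integrals_converge \<Gamma>y d2 v"
  by (drule adm, simp add: admissible_def)+

lemma biorthogonal: "biorthogonal (B u v) (\<pi> u v) (\<sigma> u v) (r u v)" if "(u, v) \<in> \<Omega>"
proof (rule biorthogonal.intro)
  have a: "double_integrals_converge \<Gamma>x \<Gamma>y d1 d2 u v" "single_integrals_converge \<Gamma>y d2 v"
    using adm[OF that] by (auto simp: admissible_def)
  show "poly_functional (\<lambda>f. B u v f g)" for g by (rule poly_functional_pairing_left[OF a(1)])
  show "poly_functional (B u v f)" for f by (rule poly_functional_pairing_right[OF a])
  show "coeff (\<pi> u v n) n = 1" "coeff (\<sigma> u v n) n = 1" for n
    using monic_\<pi>[OF that, of n] monic_\<sigma>[OF that, of n] by auto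
qed (use monic_\<pi>[OF that] monic_\<sigma>[OF that] orthogonal[OF that] r_nonzero[OF that] in auto)

lemma monom_mult_poly:
  "poly (monom (- 1 / of_nat K) K * f) = (\<lambda>x. - (x ^ K / of_nat K) * poly f x :: complex)"
  by (simp add: fun_eq_iff poly_monom)

lemma flow_u:
  assumes "(u, v) \<in> \<Omega>" "K \<in> {1..d1+1}"
  shows "biorthogonal_flow (\<lambda>t. B (u(K := t)) v) (\<lambda>t. \<pi> (u(K := t)) v) (\<lambda>t. \<sigma> (u(K := t)) v)
    (\<lambda>t. r (u(K := t)) v) (monom (- 1 / of_nat K) K) (u K)"
proof
  show "\<forall>\<^sub>F t in nhds (u K). biorthogonal (B (u(K := t)) v) (\<pi> (u(K := t)) v) (\<sigma> (u(K := t)) v) (r (u(K := t)) v)"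
    using eventually_parameter(1)[OF open_\<Omega> assms] by eventually_elim (rule biorthogonal)
  show "((\<lambda>t. B (u(K := t)) v f g) has_field_derivative
      B (u(K := u K)) v (monom (- 1 / of_nat K) K * f) g) (at (u K))" for f g
    using adm[OF assms(1)] assms(2)
    by (simp only: admissible_def double_integrals_differentiable_def monom_mult_poly fun_upd_triv)
qed (rule r_diff_u[OF assms])

lemma flow_v:
  assumes "(u, v) \<in> \<Omega>" "J \<in> {1..d2+1}"
  shows "biorthogonal_flow (\<lambda>t f g. B u (v(J := t)) g f) (\<lambda>t. \<sigma> u (v(J := t))) (\<lambda>t. \<pi> u (v(J := t)))
    (\<lambda>t. r u (v(J := t))) (monom (- 1 / of_nat J) J) (v J)"
proof
  show "\<forall>\<^sub>F t in nhds (v J). biorthogonal (\<lambda>f g. B u (v(J := t)) g f)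
      (\<sigma> u (v(J := t))) (\<pi> u (v(J := t))) (r u (v(J := t)))"
    using eventually_parameter(2)[OF open_\<Omega> assms]
    by eventually_elim (rule biorthogonal.swap[OF biorthogonal])
  show "((\<lambda>t. B u (v(J := t)) g f) has_field_derivative
      B u (v(J := v J)) g (monom (- 1 / of_nat J) J * f)) (at (v J))" for f g
    using adm[OF assms(1)] assms(2)
    by (simp only: admissible_def double_integrals_differentiable_def monom_mult_poly fun_upd_triv)
qed (rule r_diff_v[OF assms])

end

section \<open>A fixed parameter point with its recursion coefficients\<close>

locale biorthogonal_family_point = biorthogonal_family +
  fixes u v :: "nat \<Rightarrow> complex" and \<alpha> \<beta> :: "int \<Rightarrow> nat \<Rightarrow> complex" and Q P :: smat
  assumes uv: "(u, v) \<in> \<Omega>"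
    and rec: "recursion_coefficients d1 d2 (r u v) (\<psi> u v) (\<phi> u v) \<alpha> \<beta>"
    and Q: "expansion_matrix Q (\<psi> u v) (\<lambda>n x. x * \<psi> u v n x)"
    and P: "expansion_matrix P (\<psi> u v) (\<lambda>n. deriv (\<psi> u v n))"
begin

sublocale psi: biorthogonal "B u v" "\<pi> u v" "\<sigma> u v" "r u v"
  by (rule biorthogonal[OF uv])

sublocale phi: biorthogonal "\<lambda>f g. B u v g f" "\<sigma> u v" "\<pi> u v" "r u v"
  by (rule psi.swap)

lemma psi_eq: "\<psi> u v n z = poly (\<pi> u v n) z * exp (- potential d1 u z) / r u v n"
  and phi_eq: "\<phi> u v n z = poly (\<sigma> u v n) z * exp (- potential d2 v z) / r u v n"
  by (simp_all add: wave_def)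

lemma psi_recursion: "z * \<psi> u v n z = (\<Sum>m\<le>n+1. band d2 \<alpha> n m * \<psi> u v m z)"
proof -
  have "\<forall>n z. z * \<psi> u v n z = (\<Sum>j\<in>{j\<in>{-1..int d2}. 0 \<le> int n - j}. \<alpha> j n * \<psi> u v (nat (int n - j)) z)"
    using rec unfolding recursion_coefficients_def by (elim conjE)
  then show ?thesis by (simp only: sum_band[where f = "\<lambda>m. \<psi> u v m z"])
qed

lemma phi_recursion: "z * \<phi> u v n z = (\<Sum>m\<le>n+1. band d1 \<beta> n m * \<phi> u v m z)"
proof -
  have "\<forall>n z. z * \<phi> u v n z = (\<Sum>j\<in>{j\<in>{-1..int d1}. 0 \<le> int n - j}. \<beta> j n * \<phi> u v (nat (int n - j)) z)"
    using rec unfolding recursion_coefficients_def by (elim conjE)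
  then show ?thesis by (simp only: sum_band[where f = "\<lambda>m. \<phi> u v m z"])
qed

lemma psi_derivative: "deriv (\<psi> u v n) z = - (\<Sum>m\<le>n+d1. band d1 \<beta> m n * \<psi> u v m z)"
proof -
  have "\<forall>n z. deriv (\<psi> u v n) z = - (\<Sum>j\<in>{j\<in>{-1..int d1}. 0 \<le> int n + j}.
      \<beta> j (nat (int n + j)) * \<psi> u v (nat (int n + j)) z)"
    using rec unfolding recursion_coefficients_def by (elim conjE)
  then show ?thesis by (simp only: sum_band_transpose[where f = "\<lambda>m. \<psi> u v m z"])
qed

lemma deriv_psi: "deriv (\<psi> u v n) z
  = poly (pderiv (\<pi> u v n) - potential_deriv d1 u * \<pi> u v n) z * exp (- potential d1 u z) / r u v n"
proof (rule DERIV_imp_deriv)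
  show "(\<psi> u v n has_field_derivative
    poly (pderiv (\<pi> u v n) - potential_deriv d1 u * \<pi> u v n) z * exp (- potential d1 u z) / r u v n) (at z)"
    unfolding wave_def[abs_def]
  proof (rule DERIV_cdivide)
    show "((\<lambda>z. poly (\<pi> u v n) z * exp (- potential d1 u z)) has_field_derivative
      poly (pderiv (\<pi> u v n) - potential_deriv d1 u * \<pi> u v n) z * exp (- potential d1 u z)) (at z)"
      by (rule derivative_eq_intros has_field_derivative_potential poly_DERIV refl
          | simp add: algebra_simps)+
  qed
qed

lemma psi_mult_matrix: "psi.mult_matrix = Q" "psi.mult_matrix = band d2 \<alpha>"
proof -
  have q: "banded Q" "\<And>n z. z * \<psi> u v n z = (\<Sum>m. Q n m * \<psi> u v m z)"
    using Q unfolding expansion_matrix_def by blast+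
  show "psi.mult_matrix = Q"
    by (rule psi.mult_matrix_eqI[where wv = "\<psi> u v" and e = "\<lambda>z. exp (- potential d1 u z)",
          OF psi_eq exp_not_eq_zero q, symmetric])
  show "psi.mult_matrix = band d2 \<alpha>"
    by (rule psi.mult_matrix_bandI[where wv = "\<psi> u v" and e = "\<lambda>z. exp (- potential d1 u z)"])
      (rule psi_eq psi_recursion exp_not_eq_zero)+
qed

text \<open>The given recursions express \<open>deriv (\<psi> u v n)\<close> and
  \<open>y * \<phi> u v n\<close> through the same \<beta>. Comparing the former with
  \<open>P\<close>, and the latter with the multiplication by \<open>y\<close>, identifies all the
  matrices.\<close>

lemma phi_mult_matrix: "phi.mult_matrix = minus_transpose P" "phi.mult_matrix = band d1 \<beta>"
  and string_equation_psi:
    "B u v (potential_deriv d1 u * \<pi> u v n - pderiv (\<pi> u v n)) (\<sigma> u v m)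
      = r u v n * r u v m * band d1 \<beta> m n"
proof -
  let ?f = "\<lambda>n. pderiv (\<pi> u v n) - potential_deriv d1 u * \<pi> u v n"
  have p: "banded P" "\<And>n z. poly (?f n) z * exp (- potential d1 u z) / r u v n = (\<Sum>m. P n m * \<psi> u v m z)"
    using P unfolding expansion_matrix_def deriv_psi by blast+
  have P': "B u v (?f n) (\<sigma> u v m) = r u v n * r u v m * P n m" for n m
    by (rule psi.B_expansion_banded[where wv = "\<psi> u v" and e = "\<lambda>z. exp (- potential d1 u z)",
          OF psi_eq exp_not_eq_zero p psi.r_nz])
  have *: "poly (?f n) z * exp (- potential d1 u z) / r u v n
      = (\<Sum>m\<le>n+d1. - band d1 \<beta> m n * \<psi> u v m z)" for n z
    using psi_derivative[of n z] unfolding deriv_psi by (simp add: sum_negf)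
  have b: "B u v (?f n) (\<sigma> u v m) = - (r u v n * r u v m * band d1 \<beta> m n)" for n m
    using psi.B_expansion[where wv = "\<psi> u v" and e = "\<lambda>z. exp (- potential d1 u z)",
        OF psi_eq exp_not_eq_zero *[of n] psi.r_nz, of m]
    by (auto simp: band_def)
  show band: "phi.mult_matrix = band d1 \<beta>"
    by (rule phi.mult_matrix_bandI[where wv = "\<phi> u v" and e = "\<lambda>z. exp (- potential d2 v z)"])
      (rule phi_eq phi_recursion exp_not_eq_zero)+
  have "minus_transpose P = band d1 \<beta>"
  proof (intro ext)
    fix n m
    have "r u v m * r u v n * P m n = r u v m * r u v n * (- band d1 \<beta> n m)"
      using P'[of m n] b[of m n] by simp
    moreover have "r u v m * r u v n \<noteq> 0" by simp
    ultimately have "P m n = - band d1 \<beta> n m" using mult_left_cancel by blast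
    then show "minus_transpose P n m = band d1 \<beta> n m" by (simp add: minus_transpose_def)
  qed
  with band show "phi.mult_matrix = minus_transpose P" by simp
  have "potential_deriv d1 u * \<pi> u v n - pderiv (\<pi> u v n) = - ?f n" by simp
  then show "B u v (potential_deriv d1 u * \<pi> u v n - pderiv (\<pi> u v n)) (\<sigma> u v m)
      = r u v n * r u v m * band d1 \<beta> m n"
    using b by (simp only: module_hom.neg[OF psi.lin_left]) simp
qed

text \<open>
  Only here is an integration by parts under the pairing needed: the expansion of
  \<open>deriv (\<phi> u v n)\<close> is not among the given recursion relations.
\<close>

lemma string_equation_phi:
  "B u v (\<pi> u v m) (potential_deriv d2 v * \<sigma> u v n - pderiv (\<sigma> u v n))
    = r u v n * r u v m * band d2 \<alpha> m n"
proof -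
  have "B u v (\<pi> u v m) (potential_deriv d2 v * \<sigma> u v n - pderiv (\<sigma> u v n))
      = psi.mult_matrix m n * (r u v m * r u v n)"
  proof -
    have "no_boundary_terms \<Gamma>y d2 v" "single_integrals_converge \<Gamma>y d2 v"
      using adm[OF uv] by (simp_all add: admissible_def)
    from pairing_by_parts[OF this] show ?thesis by (simp add: psi.mult_matrix_def)
  qed
  then show ?thesis unfolding psi_mult_matrix(2) by simp
qed

text \<open>The string equations act crosswise: the leading coefficient of the derivative of the
  first potential controls \<beta>, that of the second controls \<alpha>.\<close>

lemma coefficients_nonzero:
  "\<alpha> (-1) n \<noteq> 0" "\<beta> (-1) n \<noteq> 0" "\<alpha> (int d2) (n + d2) \<noteq> 0" "\<beta> (int d1) (n + d1) \<noteq> 0"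
proof -
  show "\<alpha> (-1) n \<noteq> 0" "\<beta> (-1) n \<noteq> 0"
  proof -
    have "\<forall>n. \<alpha> (-1) n = r u v (n+1) / r u v n \<and> \<beta> (-1) n = r u v (n+1) / r u v n"
      using rec unfolding recursion_coefficients_def by (elim conjE)
    then show "\<alpha> (-1) n \<noteq> 0" "\<beta> (-1) n \<noteq> 0" by simp_all
  qed
  have "u (d1+1) \<noteq> 0" "v (d2+1) \<noteq> 0" using adm[OF uv] by (simp_all add: admissible_def)
  note d = degree_potential_deriv[where d = d1 and w = u, OF this(1)]
    degree_potential_deriv[where d = d2 and w = v, OF this(2)]
  show "\<alpha> (int d2) (n + d2) \<noteq> 0"
    by (rule phi.string_equation_nonzero[OF string_equation_phi d(3,4)])
  show "\<beta> (int d1) (n + d1) \<noteq> 0"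
    by (rule psi.string_equation_nonzero[OF string_equation_psi d(1,2)])
qed

text \<open>Multiplication by \<open>z\<close> becomes integration by parts in \<open>x\<close>. So
  \<psi>' obeys the column recursion with \<beta>, although \<psi> obeys the row recursion with
  \<alpha>; this is why its dual window has \<open>d1 + 1\<close> entries.\<close>

lemma psi_dual_recursion: "z * \<psi>' u v n z = (\<Sum>m\<le>n+d1. band d1 \<beta> m n * \<psi>' u v m z)"
proof -
  have a: "u (d1+1) \<noteq> 0" "no_boundary_terms \<Gamma>x d1 u" "single_integrals_converge \<Gamma>x d1 u"
    using adm[OF uv] by (auto simp: admissible_def)
  show ?thesis unfolding dual_wave_weighted_cint
  proof (rule psi.string_equation_recursion[where V = "potential_deriv d1 u" and E = "weighted_cint \<Gamma>x d1 u z"])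
    show "degree (potential_deriv d1 u) = d1" by (rule degree_potential_deriv(1)) (rule a(1))
    show "poly_functional (weighted_cint \<Gamma>x d1 u z)" by (rule poly_functional_weighted_cint[OF a(3)])
    show "weighted_cint \<Gamma>x d1 u z (potential_deriv d1 u * f - pderiv f) = z * weighted_cint \<Gamma>x d1 u z f" for f
      by (rule weighted_cint_by_parts[OF a(2,3)])
  qed (rule string_equation_psi)
qed

lemma phi_dual_recursion: "z * \<phi>' u v n z = (\<Sum>m\<le>n+d2. band d2 \<alpha> m n * \<phi>' u v m z)"
proof -
  have a: "v (d2+1) \<noteq> 0" "no_boundary_terms \<Gamma>y d2 v" "single_integrals_converge \<Gamma>y d2 v"
    using adm[OF uv] by (auto simp: admissible_def)
  show ?thesis unfolding dual_wave_weighted_cint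
  proof (rule phi.string_equation_recursion[where V = "potential_deriv d2 v" and E = "weighted_cint \<Gamma>y d2 v z"])
    show "degree (potential_deriv d2 v) = d2" by (rule degree_potential_deriv(1)) (rule a(1))
    show "poly_functional (weighted_cint \<Gamma>y d2 v z)" by (rule poly_functional_weighted_cint[OF a(3)])
    show "weighted_cint \<Gamma>y d2 v z (potential_deriv d2 v * f - pderiv f) = z * weighted_cint \<Gamma>y d2 v z f" for f
      by (rule weighted_cint_by_parts[OF a(2,3)])
  qed (rule string_equation_phi)
qed

text \<open>\<open>u K\<close> enters only the weight in \<open>x\<close>. Hence \<psi> and \<psi>'
  are left waves with a moving functional, while \<phi> and \<phi>' are right waves with a fixed
  one.\<close>

lemma deformation_u:
  assumes K: "K \<in> {1..d1+1}"
  shows "((\<lambda>t. \<psi> (u(K := t)) v n z) has_field_derivative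
      (\<Sum>j\<le>K. deformation Q K n (n+j) * \<psi> u v (n+j) z)) (at (u K))"
    and "((\<lambda>t. \<psi>' (u(K := t)) v n z) has_field_derivative
      (\<Sum>j\<le>K. deformation Q K n (n+j) * \<psi>' u v (n+j) z)) (at (u K))"
    and "K \<le> n \<Longrightarrow> ((\<lambda>t. \<phi> (u(K := t)) v n z) has_field_derivative
      - (\<Sum>j\<le>K. deformation Q K (n-j) n * \<phi> u v (n-j) z)) (at (u K))"
    and "K \<le> n \<Longrightarrow> ((\<lambda>t. \<phi>' (u(K := t)) v n z) has_field_derivative
      - (\<Sum>j\<le>K. deformation Q K (n-j) n * \<phi>' u v (n-j) z)) (at (u K))"
proof -
  have ev: "\<forall>\<^sub>F t in nhds (u K). (u(K := t), v) \<in> \<Omega>"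
    by (rule eventually_parameter(1)[OF open_\<Omega> uv K])
  have diff: "single_integrals_differentiable \<Gamma>x d1 u" and conv: "single_integrals_converge \<Gamma>y d2 v"
    using adm[OF uv] by (auto simp: admissible_def)
  note L = biorthogonal_flow.derivative_left_wave_deformation[OF flow_u[OF uv K] refl,
      unfolded fun_upd_triv psi_mult_matrix(1)]
  note R = biorthogonal_flow.derivative_right_wave_deformation[OF flow_u[OF uv K] refl,
      unfolded fun_upd_triv psi_mult_matrix(1)]
  show "((\<lambda>t. \<psi> (u(K := t)) v n z) has_field_derivative
      (\<Sum>j\<le>K. deformation Q K n (n+j) * \<psi> u v (n+j) z)) (at (u K))"
    using L[where E = "\<lambda>t f. poly f z * exp (- potential d1 (u(K := t)) z)", unfolded fun_upd_triv,
        OF always_eventually[OF allI[OF poly_functional_weight]] has_field_derivative_weight[OF K]]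
    by (simp only: wave_def)
  \<comment> \<open>Linearity of the integral rests on convergence, which is known only inside
    \<open>\<Omega>\<close>; evaluation at a point above was linear for every
    \<open>t\<close>.\<close>
  have "\<forall>\<^sub>F t in nhds (u K). poly_functional (weighted_cint \<Gamma>x d1 (u(K := t)) z)"
    using ev by eventually_elim (rule poly_functional_weighted_cint[OF converge_x])
  from L[where E = "\<lambda>t. weighted_cint \<Gamma>x d1 (u(K := t)) z", unfolded fun_upd_triv,
      OF this has_field_derivative_weighted_cint[OF diff K]]
  show "((\<lambda>t. \<psi>' (u(K := t)) v n z) has_field_derivative
      (\<Sum>j\<le>K. deformation Q K n (n+j) * \<psi>' u v (n+j) z)) (at (u K))"
    by (simp only: dual_wave_weighted_cint)
  show "((\<lambda>t. \<phi> (u(K := t)) v n z) has_field_derivative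
      - (\<Sum>j\<le>K. deformation Q K (n-j) n * \<phi> u v (n-j) z)) (at (u K))" if "K \<le> n"
    using R[OF poly_functional_weight that] by (simp only: wave_def)
  show "((\<lambda>t. \<phi>' (u(K := t)) v n z) has_field_derivative
      - (\<Sum>j\<le>K. deformation Q K (n-j) n * \<phi>' u v (n-j) z)) (at (u K))" if "K \<le> n"
    using R[OF poly_functional_weighted_cint[OF conv] that] by (simp only: dual_wave_weighted_cint)
qed

text \<open>\<open>v J\<close> enters only the weight in \<open>y\<close>, so \<phi> and \<phi>' are
  now the left waves, and \<open>- P\<^sup>t\<close> takes the place of \<open>Q\<close>.\<close>

lemma deformation_v:
  assumes J: "J \<in> {1..d2+1}"
  shows "((\<lambda>t. \<phi> u (v(J := t)) n z) has_field_derivative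
      (\<Sum>j\<le>J. deformation (minus_transpose P) J n (n+j) * \<phi> u v (n+j) z)) (at (v J))"
    and "((\<lambda>t. \<phi>' u (v(J := t)) n z) has_field_derivative
      (\<Sum>j\<le>J. deformation (minus_transpose P) J n (n+j) * \<phi>' u v (n+j) z)) (at (v J))"
    and "J \<le> n \<Longrightarrow> ((\<lambda>t. \<psi> u (v(J := t)) n z) has_field_derivative
      - (\<Sum>j\<le>J. deformation (minus_transpose P) J (n-j) n * \<psi> u v (n-j) z)) (at (v J))"
    and "J \<le> n \<Longrightarrow> ((\<lambda>t. \<psi>' u (v(J := t)) n z) has_field_derivative
      - (\<Sum>j\<le>J. deformation (minus_transpose P) J (n-j) n * \<psi>' u v (n-j) z)) (at (v J))"
proof -
  have ev: "\<forall>\<^sub>F t in nhds (v J). (u, v(J := t)) \<in> \<Omega>"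
    by (rule eventually_parameter(2)[OF open_\<Omega> uv J])
  have diff: "single_integrals_differentiable \<Gamma>y d2 v" and conv: "single_integrals_converge \<Gamma>x d1 u"
    using adm[OF uv] by (auto simp: admissible_def)
  note L = biorthogonal_flow.derivative_left_wave_deformation[OF flow_v[OF uv J] refl,
      unfolded fun_upd_triv phi_mult_matrix(1)]
  note R = biorthogonal_flow.derivative_right_wave_deformation[OF flow_v[OF uv J] refl,
      unfolded fun_upd_triv phi_mult_matrix(1)]
  show "((\<lambda>t. \<phi> u (v(J := t)) n z) has_field_derivative
      (\<Sum>j\<le>J. deformation (minus_transpose P) J n (n+j) * \<phi> u v (n+j) z)) (at (v J))"
    using L[where E = "\<lambda>t f. poly f z * exp (- potential d2 (v(J := t)) z)", unfolded fun_upd_triv,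
        OF always_eventually[OF allI[OF poly_functional_weight]] has_field_derivative_weight[OF J]]
    by (simp only: wave_def)
  have "\<forall>\<^sub>F t in nhds (v J). poly_functional (weighted_cint \<Gamma>y d2 (v(J := t)) z)"
    using ev by eventually_elim (rule poly_functional_weighted_cint[OF converge_y])
  from L[where E = "\<lambda>t. weighted_cint \<Gamma>y d2 (v(J := t)) z", unfolded fun_upd_triv,
      OF this has_field_derivative_weighted_cint[OF diff J]]
  show "((\<lambda>t. \<phi>' u (v(J := t)) n z) has_field_derivative
      (\<Sum>j\<le>J. deformation (minus_transpose P) J n (n+j) * \<phi>' u v (n+j) z)) (at (v J))"
    by (simp only: dual_wave_weighted_cint)
  show "((\<lambda>t. \<psi> u (v(J := t)) n z) has_field_derivative
      - (\<Sum>j\<le>J. deformation (minus_transpose P) J (n-j) n * \<psi> u v (n-j) z)) (at (v J))" if "J \<le> n"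
    using R[OF poly_functional_weight that] by (simp only: wave_def)
  show "((\<lambda>t. \<psi>' u (v(J := t)) n z) has_field_derivative
      - (\<Sum>j\<le>J. deformation (minus_transpose P) J (n-j) n * \<psi>' u v (n-j) z)) (at (v J))" if "J \<le> n"
    using R[OF poly_functional_weighted_cint[OF conv] that] by (simp only: dual_wave_weighted_cint)
qed

end

theorem lemma2p8:
  fixes d1 d2 :: nat
    and \<Gamma>x \<Gamma>y :: contour
    and \<Omega> :: "((nat \<Rightarrow> complex) \<times> (nat \<Rightarrow> complex)) set"
    and \<pi> \<sigma> :: "(nat \<Rightarrow> complex) \<Rightarrow> (nat \<Rightarrow> complex) \<Rightarrow> nat \<Rightarrow> complex poly"
    and h r :: "(nat \<Rightarrow> complex) \<Rightarrow> (nat \<Rightarrow> complex) \<Rightarrow> nat \<Rightarrow> complex"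
    and \<psi> \<phi> \<psi>' \<phi>' :: "(nat \<Rightarrow> complex) \<Rightarrow> (nat \<Rightarrow> complex) \<Rightarrow> nat \<Rightarrow> complex \<Rightarrow> complex"
    and u v :: "nat \<Rightarrow> complex"
    and \<alpha> \<beta> :: "int \<Rightarrow> nat \<Rightarrow> complex"
    and Q P :: smat
  assumes "d1 \<ge> 1" and "d2 \<ge> 1"
    and "is_contour \<Gamma>x" and "is_contour \<Gamma>y"
    and "open_parameters d1 d2 \<Omega>"
    and "\<And>u v. (u, v) \<in> \<Omega> \<Longrightarrow> admissible \<Gamma>x \<Gamma>y d1 d2 u v"
    and "\<And>u v n. (u, v) \<in> \<Omega> \<Longrightarrow> degree (\<pi> u v n) = n \<and> lead_coeff (\<pi> u v n) = 1"
    and "\<And>u v n. (u, v) \<in> \<Omega> \<Longrightarrow> degree (\<sigma> u v n) = n \<and> lead_coeff (\<sigma> u v n) = 1"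
    and "\<And>u v n m. (u, v) \<in> \<Omega> \<Longrightarrow>
           pairing \<Gamma>x \<Gamma>y d1 d2 u v (poly (\<pi> u v n)) (poly (\<sigma> u v m)) = (if n = m then h u v n else 0)"
    and "\<And>u v n. (u, v) \<in> \<Omega> \<Longrightarrow> h u v n \<noteq> 0"
    and "\<And>u v n. (u, v) \<in> \<Omega> \<Longrightarrow> (r u v n)\<^sup>2 = h u v n"
    and "\<And>u v n K. (u, v) \<in> \<Omega> \<Longrightarrow> K \<in> {1..d1+1} \<Longrightarrow>
           (\<lambda>t. r (u(K := t)) v n) field_differentiable (at (u K))"
    and "\<And>u v n J. (u, v) \<in> \<Omega> \<Longrightarrow> J \<in> {1..d2+1} \<Longrightarrow>
           (\<lambda>t. r u (v(J := t)) n) field_differentiable (at (v J))"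
    and "\<And>u v. \<psi> u v = wave d1 u (\<pi> u v) (r u v)"
    and "\<And>u v. \<phi> u v = wave d2 v (\<sigma> u v) (r u v)"
    and "\<And>u v. \<psi>' u v = dual_wave \<Gamma>x (\<psi> u v)"
    and "\<And>u v. \<phi>' u v = dual_wave \<Gamma>y (\<phi> u v)"
    and "(u, v) \<in> \<Omega>"
    and "recursion_coefficients d1 d2 (r u v) (\<psi> u v) (\<phi> u v) \<alpha> \<beta>"
    and "expansion_matrix Q (\<psi> u v) (\<lambda>n x. x * \<psi> u v n x)"
    and "expansion_matrix P (\<psi> u v) (\<lambda>n. deriv (\<psi> u v n))"
  shows "\<forall>K\<in>{1..d1+1}. \<forall>J\<in>{1..d2+1}. \<forall>N x y.
    (let U = deformation Q K;
         V = deformation (minus_transpose P) J;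
         \<Psi> = (\<lambda>u v. window d2 (\<psi> u v) N x);
         \<Psi>' = (\<lambda>u v. dual_window d1 (\<psi>' u v) (N - 1) y);
         \<Phi> = (\<lambda>u v. window d1 (\<phi> u v) N y);
         \<Phi>' = (\<lambda>u v. dual_window d2 (\<phi>' u v) (N - 1) x);
         a = ladder d2 \<alpha> x;
         b = ladder d1 \<beta> y;
         a' = dual_ladder d2 \<alpha> x;
         b' = dual_ladder d1 \<beta> y
     in
       (d2 \<le> N \<longrightarrow>
          has_mat_derivative (\<lambda>t. \<Psi> (u(K := t)) v) (U_psi d2 U a K N * \<Psi> u v) (u K)) \<and>
       (d2 + J \<le> N \<longrightarrow>
          has_mat_derivative (\<lambda>t. \<Psi> u (v(J := t))) (- (V_psi d2 V a J N * \<Psi> u v)) (v J)) \<and>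
       (1 \<le> N \<longrightarrow>
          has_mat_derivative (\<lambda>t. \<Psi>' (u(K := t)) v) (\<Psi>' u v * U_psi_dual d1 U b' K N) (u K)) \<and>
       (J + 1 \<le> N \<longrightarrow>
          has_mat_derivative (\<lambda>t. \<Psi>' u (v(J := t))) (- (\<Psi>' u v * V_psi_dual d1 V b' J N)) (v J)) \<and>
       (d1 + K \<le> N \<longrightarrow>
          has_mat_derivative (\<lambda>t. \<Phi> (u(K := t)) v) (- (U_phi d1 U b K N * \<Phi> u v)) (u K)) \<and>
       (d1 \<le> N \<longrightarrow>
          has_mat_derivative (\<lambda>t. \<Phi> u (v(J := t))) (V_phi d1 V b J N * \<Phi> u v) (v J)) \<and>
       (K + 1 \<le> N \<longrightarrow>
          has_mat_derivative (\<lambda>t. \<Phi>' (u(K := t)) v) (- (\<Phi>' u v * U_phi_dual d2 U a' K N)) (u K)) \<and>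
       (1 \<le> N \<longrightarrow>
          has_mat_derivative (\<lambda>t. \<Phi>' u (v(J := t))) (\<Phi>' u v * V_phi_dual d2 V a' J N) (v J)))"
proof -
  interpret biorthogonal_family_point d1 d2 \<Gamma>x \<Gamma>y \<Omega> \<pi> \<sigma> r u v \<alpha> \<beta> Q P
  proof
    show "r u v n \<noteq> 0" if "(u, v) \<in> \<Omega>" for u v n
      using assms(10)[OF that, of n] assms(11)[OF that, of n] by auto
    show "pairing \<Gamma>x \<Gamma>y d1 d2 u v (poly (\<pi> u v n)) (poly (\<sigma> u v m)) = (if n = m then (r u v n)\<^sup>2 else 0)"
      if "(u, v) \<in> \<Omega>" for u v n m
      using assms(9)[OF that] assms(11)[OF that] by simp
  qed (rule assms(5-8) assms(12,13) assms(18-21)[unfolded assms(14-17)] | assumption)+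
  note fold = assms(14-17)[symmetric]
  \<comment> \<open>Row recursions drive the windows, column recursions the dual windows; a function
    and its dual use different coefficient families.\<close>
  note rec = psi_recursion[unfolded fold] phi_recursion[unfolded fold]
    psi_dual_recursion[unfolded fold] phi_dual_recursion[unfolded fold]
  \<comment> \<open>With the \<open>V\<close>-sums rewritten, each of the eight equations has one of
    four shapes: raising or lowering the index, on a window or on a dual window.\<close>
  show ?thesis
    unfolding Let_def V_psi_eq_U_phi V_phi_eq_U_psi V_psi_dual_eq_U_phi_dual
      V_phi_dual_eq_U_psi_dual
  proof (intro ballI allI conjI impI)
    fix K J N :: nat and x y :: complex
    assume K: "K \<in> {1..d1+1}" and J: "J \<in> {1..d2+1}"
    note u = deformation_u[OF K, unfolded fold] and v = deformation_v[OF J, unfolded fold]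
    \<comment> \<open>The facts \<open>nz(3)\<close> and \<open>nz(4)\<close> enter exactly where
      inverse shifts occur: lowering on windows and raising on dual windows.\<close>
    note nz = coefficients_nonzero
    {
      assume "d2 \<le> N"
      then show "has_mat_derivative (\<lambda>t. window d2 (\<psi> (u(K := t)) v) N x)
          (U_psi d2 (deformation Q K) (ladder d2 \<alpha> x) K N * window d2 (\<psi> u v) N x) (u K)"
        by (rule has_mat_derivative_U_psi[OF rec(1) nz(1) _ u(1)])
    next
      assume "d2 + J \<le> N"
      then show "has_mat_derivative (\<lambda>t. window d2 (\<psi> u (v(J := t))) N x)
          (- (U_phi d2 (deformation (minus_transpose P) J) (ladder d2 \<alpha> x) J N * window d2 (\<psi> u v) N x)) (v J)"
        by (rule has_mat_derivative_U_phi[OF rec(1) nz(1) nz(3) assms(2) _ v(3)])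
    next
      assume "1 \<le> N"
      then show "has_mat_derivative (\<lambda>t. dual_window d1 (\<psi>' (u(K := t)) v) (N - 1) y)
          (dual_window d1 (\<psi>' u v) (N - 1) y * U_psi_dual d1 (deformation Q K) (dual_ladder d1 \<beta> y) K N) (u K)"
        by (rule has_mat_derivative_U_psi_dual[OF rec(3) nz(2) nz(4) assms(1) _ u(2)])
    next
      assume "J + 1 \<le> N"
      then show "has_mat_derivative (\<lambda>t. dual_window d1 (\<psi>' u (v(J := t))) (N - 1) y)
          (- (dual_window d1 (\<psi>' u v) (N - 1) y *
            U_phi_dual d1 (deformation (minus_transpose P) J) (dual_ladder d1 \<beta> y) J N)) (v J)"
        by (rule has_mat_derivative_U_phi_dual[OF rec(3) nz(2) _ v(4)])
    next
      assume "d1 + K \<le> N"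
      then show "has_mat_derivative (\<lambda>t. window d1 (\<phi> (u(K := t)) v) N y)
          (- (U_phi d1 (deformation Q K) (ladder d1 \<beta> y) K N * window d1 (\<phi> u v) N y)) (u K)"
        by (rule has_mat_derivative_U_phi[OF rec(2) nz(2) nz(4) assms(1) _ u(3)])
    next
      assume "d1 \<le> N"
      then show "has_mat_derivative (\<lambda>t. window d1 (\<phi> u (v(J := t))) N y)
          (U_psi d1 (deformation (minus_transpose P) J) (ladder d1 \<beta> y) J N * window d1 (\<phi> u v) N y) (v J)"
        by (rule has_mat_derivative_U_psi[OF rec(2) nz(2) _ v(1)])
    next
      assume "K + 1 \<le> N"
      then show "has_mat_derivative (\<lambda>t. dual_window d2 (\<phi>' (u(K := t)) v) (N - 1) x)
          (- (dual_window d2 (\<phi>' u v) (N - 1) x * U_phi_dual d2 (deformation Q K) (dual_ladder d2 \<alpha> x) K N)) (u K)"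
        by (rule has_mat_derivative_U_phi_dual[OF rec(4) nz(1) _ u(4)])
    next
      assume "1 \<le> N"
      then show "has_mat_derivative (\<lambda>t. dual_window d2 (\<phi>' u (v(J := t))) (N - 1) x)
          (dual_window d2 (\<phi>' u v) (N - 1) x *
            U_psi_dual d2 (deformation (minus_transpose P) J) (dual_ladder d2 \<alpha> x) J N) (v J)"
        by (rule has_mat_derivative_U_psi_dual[OF rec(4) nz(1) nz(3) assms(2) _ v(2)])
    }
  qed
qed

end
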